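(* Let $F(x,y,z)\in\mathbb{Q}[x,y,z]$ be a symmetric polynomial of degree $d\ge0$, and let $T=\max\{\lfloor (d+1)/2\rfloor,1\}$. There are polynomials $C_{F,k}(x)\in\mathbb{Q}[x]$ ($0\le k\le T$), depending only on $F$ and $k$ and each of degree at most $d+2$, such that for every positive integer $n\ge d+2$, $$\sum_{\substack{i+j+k=n\\ i,j,k\ge1}}F(i,j,k)\,\zeta(2i,2j,2k)=\sum_{k=0}^{T}C_{F,k}(n)\,\zeta(2k)\zeta(2n-2k).$$
   Context: $\zeta$ is the Riemann zeta function, with $\zeta(0)=-1/2$; $\zeta(a,b,c)=\sum_{m_1>m_2>m_3>0}m_1^{-a}m_2^{-b}m_3^{-c}$ is the triple zeta value. *)

theory Defs
  imports
    "HOL-Analysis.Analysis"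
    "HOL-Library.Poly_Mapping"
    "HOL-Computational_Algebra.Polynomial"
begin

text \<open>
  The ring of polynomials in three variables is the monoid algebra of \<open>nat \<times> nat \<times> nat\<close>:
  the exponent triple \<open>(a, b, c)\<close> stands for the monomial \<open>x^a y^b z^c\<close>, and the keys are
  the exponents of the monomials with nonzero coefficient.
\<close>

type_synonym 'a poly3 = "nat \<times> nat \<times> nat \<Rightarrow>\<^sub>0 'a"

definition eval3 :: "'a::comm_semiring_1 poly3 \<Rightarrow> 'a \<Rightarrow> 'a \<Rightarrow> 'a \<Rightarrow> 'a" where
  "eval3 F x y z =
     (\<Sum>(a, b, c)\<in>Poly_Mapping.keys F. Poly_Mapping.lookup F (a, b, c) * x ^ a * y ^ b * z ^ c)"

text \<open>Meaningful for nonzero polynomials only (\<open>Max {}\<close> is unspecified).\<close>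

definition total_degree3 :: "'a::zero poly3 \<Rightarrow> nat" where
  "total_degree3 F = Max ((\<lambda>(a, b, c). a + b + c) ` Poly_Mapping.keys F)"

text \<open>
  Invariance under all permutations of the three variables; permuting the variables permutes
  the exponents of each monomial.
\<close>

definition symmetric3 :: "'a::zero poly3 \<Rightarrow> bool" where
  "symmetric3 F \<longleftrightarrow> (\<forall>a b c.
     Poly_Mapping.lookup F (a, c, b) = Poly_Mapping.lookup F (a, b, c) \<and>
     Poly_Mapping.lookup F (b, a, c) = Poly_Mapping.lookup F (a, b, c) \<and>
     Poly_Mapping.lookup F (b, c, a) = Poly_Mapping.lookup F (a, b, c) \<and>
     Poly_Mapping.lookup F (c, a, b) = Poly_Mapping.lookup F (a, b, c) \<and>
     Poly_Mapping.lookup F (c, b, a) = Poly_Mapping.lookup F (a, b, c))"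

text \<open>
  The Riemann zeta function at natural numbers: the Dirichlet series at \<open>s \<ge> 2\<close> and the value
  \<open>-1/2\<close> of its analytic continuation at \<open>0\<close>. The pole \<open>s = 1\<close> yields a dummy value.
\<close>

definition zeta :: "nat \<Rightarrow> real" where
  "zeta s = (if s = 0 then - 1 / 2 else suminf (\<lambda>m. 1 / real (Suc m) ^ s))"

definition triple_zeta :: "nat \<Rightarrow> nat \<Rightarrow> nat \<Rightarrow> real" where
  "triple_zeta a b c =
     (\<Sum>\<^sub>\<infinity>(m\<^sub>1, m\<^sub>2, m\<^sub>3)\<in>{(m\<^sub>1, m\<^sub>2, m\<^sub>3). m\<^sub>1 > m\<^sub>2 \<and> m\<^sub>2 > m\<^sub>3 \<and> m\<^sub>3 > 0}.
        1 / (real m\<^sub>1 ^ a * real m\<^sub>2 ^ b * real m\<^sub>3 ^ c))"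

end

theory Submission
  imports Defs "HOL-Computational_Algebra.Formal_Power_Series"
begin

text \<open>
  Since \<open>F\<close> is symmetric, the sum over \<open>m\<^sub>1 > m\<^sub>2 > m\<^sub>3\<close> may be replaced by one sixth of the sum
  over pairwise distinct triples, and inclusion-exclusion expresses the latter through products of
  values of \<open>\<zeta>\<close> at even arguments. By Euler's identity
  \<open>\<Sum>\<^bsub>0<k<n\<^esub> \<zeta>(2k) \<zeta>(2n-2k) = (n + 1/2) \<zeta>(2n)\<close> we have \<open>\<zeta>(2n) = z\<^sub>n \<zeta>(2)^n\<close> with \<open>z\<^sub>n\<close> rational,
  and \<open>H = \<Sum> z\<^sub>n X^n\<close> satisfies \<open>\<theta> H = H\<^sup>2 - H/2 + 3X/2\<close> with \<open>\<theta> = X d/dX\<close>. Give \<open>H\<close>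
  weight 1 and \<open>X\<close> weight 2. Then \<open>\<theta>\<close> raises weights by at most 1, so \<open>\<theta>\<^sup>a H \<cdot> \<theta>\<^sup>b H \<cdot> \<theta>\<^sup>c H\<close> is a
  polynomial in \<open>H\<close> and \<open>X\<close> of weight at most \<open>a + b + c + 3\<close>, and the differential equation turns it
  into a combination of terms \<open>X\<^sup>i \<theta>\<^sup>j H\<close> and \<open>X\<^sup>i\<close> of no larger weight. The coefficients of
  \<open>X\<^sup>i \<theta>\<^sup>j H\<close> are \<open>(n - i)^j z\<^bsub>n-i\<^esub>\<close>, which has the required shape.

  This bounds \<open>i\<close> by \<open>(d + 2) div 2\<close>. The bound \<open>(d + 1) div 2\<close> holds because the top-weight part of
  \<open>\<theta>\<^sup>a H\<close> with \<open>a > 0\<close> is divisible by \<open>H\<^sup>2 + 3X/2\<close>, the top-weight part of \<open>\<theta> H\<close>, so that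
  \<open>X\<^sup>i H\<close> does not occur in top weight. The exception \<open>a = b = c = 0\<close>, where \<open>H\<^sup>3\<close> does produce
  \<open>X H\<close>, is the reason for the maximum with 1 in \<open>T\<close>.
\<close>

unbundle no vec_syntax
unbundle fps_syntax

section \<open>Euler's identity for even zeta values\<close>

definition zeta_partial :: "nat \<Rightarrow> nat \<Rightarrow> real" where
  "zeta_partial s N = (\<Sum>m=1..N. 1 / real m ^ s)"

lemma zeta_sums:
  assumes "s \<ge> 2"
  shows "(\<lambda>m. 1 / real (Suc m) ^ s) sums zeta s"
proof -
  have "summable (\<lambda>m. inverse (real (Suc m) ^ s))"
    using inverse_power_summable[OF assms, where 'a = real] by (subst summable_Suc_iff)
  then show ?thesis
    using assms by (simp add: zeta_def summable_sums inverse_eq_divide)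
qed

lemma zeta_partial_tendsto:
  assumes "s \<ge> 2"
  shows "zeta_partial s \<longlonglongrightarrow> zeta s"
proof -
  have "zeta_partial s = (\<lambda>N. \<Sum>m<N. 1 / real (Suc m) ^ s)"
    unfolding zeta_partial_def
    by (rule ext, rule sum.reindex_bij_witness[of _ Suc "\<lambda>m. m - 1"]) auto
  then show ?thesis
    using zeta_sums[OF assms] by (simp add: sums_def)
qed

lemma zeta_pos:
  assumes "s \<ge> 2"
  shows "zeta s > 0"
proof -
  have "0 < suminf (\<lambda>m. 1 / real (Suc m) ^ s)"
    using zeta_sums[OF assms] by (intro suminf_pos) (auto simp: sums_iff)
  then show ?thesis using assms by (simp add: zeta_def)
qed

lemma sum_inverse_diff:
  assumes "1 \<le> p" "p \<le> N"
  shows "(\<Sum>q\<in>{1..N} - {p}. 1 / (real q - real p)) = harm (N - p) - harm (p - 1)"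
proof -
  have "{1..N} - {p} = {1..p - 1} \<union> {Suc p..N}" using assms by auto
  then have "(\<Sum>q\<in>{1..N} - {p}. 1 / (real q - real p)) =
     (\<Sum>q=1..p-1. 1 / (real q - real p)) + (\<Sum>q=Suc p..N. 1 / (real q - real p))"
    using assms by (simp add: sum.union_disjoint)
  also have "(\<Sum>q=1..p-1. 1 / (real q - real p)) = (\<Sum>q=1..p-1. - inverse (real q))"
    by (rule sum.reindex_bij_witness[of _ "\<lambda>q. p - q" "\<lambda>q. p - q"])
      (auto simp: of_nat_diff divide_simps)
  also have "(\<Sum>q=Suc p..N. 1 / (real q - real p)) = (\<Sum>q=1..N-p. inverse (real q))"
    by (rule sum.reindex_bij_witness[of _ "\<lambda>q. q + p" "\<lambda>q. q - p"])
      (auto simp: of_nat_diff divide_simps)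
  finally show ?thesis by (simp add: harm_def sum_negf)
qed

lemma sum_inverse_add:
  "(\<Sum>q=1..N. 1 / (real q + real p)) = harm (N + p) - harm p"
proof -
  have "{1..N + p} = {1..p} \<union> {Suc p..N + p}" by auto
  then have "harm (N + p) = harm p + (\<Sum>q=Suc p..N+p. inverse (real q))"
    unfolding harm_def by (simp add: sum.union_disjoint)
  also have "(\<Sum>q=Suc p..N+p. inverse (real q)) = (\<Sum>q=1..N. 1 / (real q + real p))"
    by (rule sum.reindex_bij_witness[of _ "\<lambda>q. q + p" "\<lambda>q. q - p"])
      (auto simp: of_nat_diff divide_simps)
  finally show ?thesis by simp
qed

text \<open>Partial fractions reduce this to two harmonic sums. The constant is (1/p + 1/(2p)) /
  (2p): 1/p is \<open>harm p - harm (p - 1)\<close>, and 1/(2p) corrects for the omitted index q = p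
  in the sum of 1/(q + p).\<close>

lemma sum_inverse_diff_squares:
  assumes "1 \<le> p" "p \<le> N"
  shows "(\<Sum>q\<in>{1..N} - {p}. 1 / (real q ^ 2 - real p ^ 2)) =
    3 / (4 * real p ^ 2) - (harm (N + p) - harm (N - p)) / (2 * real p)"
proof -
  have "(\<Sum>q\<in>{1..N} - {p}. 1 / (real q ^ 2 - real p ^ 2)) =
    (\<Sum>q\<in>{1..N} - {p}. (1 / (real q - real p) - 1 / (real q + real p)) / (2 * real p))"
  proof (rule sum.cong[OF refl])
    fix q assume "q \<in> {1..N} - {p}"
    then have "real q - real p \<noteq> 0" "real q + real p \<noteq> 0" "real p \<noteq> 0"
      using assms by auto
    moreover have "real q ^ 2 - real p ^ 2 = (real q - real p) * (real q + real p)"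
      by (simp add: power2_eq_square algebra_simps)
    ultimately show "1 / (real q ^ 2 - real p ^ 2) =
      (1 / (real q - real p) - 1 / (real q + real p)) / (2 * real p)"
      by (simp add: diff_frac_eq)
  qed
  also have "\<dots> = ((\<Sum>q\<in>{1..N} - {p}. 1 / (real q - real p)) -
     ((\<Sum>q=1..N. 1 / (real q + real p)) - 1 / (2 * real p))) / (2 * real p)"
    using assms by (simp add: sum_divide_distrib[symmetric] sum_subtractf sum_diff1)
  also have "\<dots> = (harm (N - p) - harm (p - 1) - (harm (N + p) - harm p - 1 / (2 * real p)))
      / (2 * real p)"
    using sum_inverse_diff[OF assms] sum_inverse_add by simp
  also have "harm p = harm (p - 1) + 1 / real p"
    using assms harm_Suc[of "p - 1", where 'a = real] by (simp add: inverse_eq_divide)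
  finally show ?thesis
    using assms by (simp add: diff_divide_distrib add_divide_distrib power2_eq_square)
qed

lemma sum_powers_mult_diff:
  fixes a b :: "'a::comm_ring_1"
  assumes "n \<ge> 1"
  shows "(a - b) * (\<Sum>k=1..<n. a ^ k * b ^ (n - k)) = a ^ n * b - a * b ^ n"
  using assms
proof (induction n rule: nat_induct_at_least)
  case (Suc n)
  have "(\<Sum>k=1..<n. a ^ k * b ^ (Suc n - k)) = b * (\<Sum>k=1..<n. a ^ k * b ^ (n - k))"
    unfolding sum_distrib_left by (rule sum.cong) (auto simp: Suc_diff_le algebra_simps)
  then have "(\<Sum>k=1..<Suc n. a ^ k * b ^ (Suc n - k)) =
     b * (\<Sum>k=1..<n. a ^ k * b ^ (n - k)) + a ^ n * b"
    using Suc.hyps by simp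
  then have "(a - b) * (\<Sum>k=1..<Suc n. a ^ k * b ^ (Suc n - k)) =
     b * ((a - b) * (\<Sum>k=1..<n. a ^ k * b ^ (n - k))) + (a - b) * a ^ n * b"
    by (simp add: algebra_simps)
  then show ?case unfolding Suc.IH by (simp add: algebra_simps)
qed simp

text \<open>A finite geometric sum in a = 1/p^2 and b = 1/q^2; the denominator comes from (a -
  b)/(ab) = q^2 - p^2.\<close>

lemma sum_inverse_powers_neq:
  assumes "1 \<le> p" "1 \<le> q" "p \<noteq> q" "n \<ge> 2"
  shows "(\<Sum>k=1..<n. 1 / real p ^ (2 * k) * (1 / real q ^ (2 * n - 2 * k))) =
    (1 / real p ^ (2 * n - 2) - 1 / real q ^ (2 * n - 2)) / (real q ^ 2 - real p ^ 2)"
proof -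
  define a b where "a = 1 / real p ^ 2" and "b = 1 / real q ^ 2"
  have nz: "real p \<noteq> 0" "real q \<noteq> 0" "real q ^ 2 - real p ^ 2 \<noteq> 0"
    using assms by (auto simp: power2_eq_iff)
  obtain m where m: "n = Suc m" using assms by (cases n) auto
  have pw: "1 / real p ^ (2 * k) = a ^ k" "1 / real q ^ (2 * k) = b ^ k" for k
    by (simp_all add: a_def b_def power_mult power_one_over)
  have "a \<noteq> 0" "b \<noteq> 0" using nz by (auto simp: a_def b_def)
  have ab: "real q ^ 2 - real p ^ 2 = (a - b) / (a * b)"
    using nz by (simp add: a_def b_def field_simps)
  then have "a - b \<noteq> 0" using nz by auto
  have "(\<Sum>k=1..<n. 1 / real p ^ (2 * k) * (1 / real q ^ (2 * n - 2 * k))) =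
     (\<Sum>k=1..<n. a ^ k * b ^ (n - k))"
    by (simp only: diff_mult_distrib2[symmetric] pw)
  also have "\<dots> = (a ^ n * b - a * b ^ n) / (a - b)"
    using sum_powers_mult_diff[of n a b] assms \<open>a - b \<noteq> 0\<close> by (simp add: field_simps)
  also have "\<dots> = (a ^ m - b ^ m) / ((a - b) / (a * b))"
    using \<open>a \<noteq> 0\<close> \<open>b \<noteq> 0\<close> by (simp add: m algebra_simps)
  finally show ?thesis
    using pw[of m] by (simp add: m ab)
qed

lemma harm_diff_le:
  assumes "p \<le> N"
  shows "harm (N + p) - harm (N - p) \<le> 2 * real p / (real N - real p + 1)"
proof -
  have "{1..N + p} = {1..N - p} \<union> {Suc (N - p)..N + p}" by auto
  then have "harm (N + p) - harm (N - p) = (\<Sum>q=Suc (N - p)..N+p. inverse (real q))"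
    unfolding harm_def by (simp add: sum.union_disjoint)
  also have "\<dots> \<le> (\<Sum>q=Suc (N - p)..N+p. inverse (real N - real p + 1))"
    by (intro sum_mono) (use assms in \<open>auto simp: field_simps of_nat_diff\<close>)
  also have "\<dots> = 2 * real p / (real N - real p + 1)"
    using assms by (simp add: field_simps)
  finally show ?thesis .
qed

text \<open>A finite form of Euler's identity with explicit error term. In the double sum over p and
  q the diagonal contributes n - 1, and by symmetry the rest contributes twice the 3/4 from
  \<open>sum_inverse_diff_squares\<close>; together n + 1/2.\<close>

lemma sum_zeta_partial_prod:
  assumes "n \<ge> 2"
  shows "(\<Sum>k=1..<n. zeta_partial (2 * k) N * zeta_partial (2 * n - 2 * k) N) =
    (real n + 1 / 2) * zeta_partial (2 * n) N -
    (\<Sum>p=1..N. (harm (N + p) - harm (N - p)) / real p ^ (2 * n - 1))"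
proof -
  let ?f = "\<lambda>p q. \<Sum>k=1..<n. 1 / real p ^ (2 * k) * (1 / real q ^ (2 * n - 2 * k))"
  let ?g = "\<lambda>p q. 1 / real p ^ (2 * n - 2) / (real q ^ 2 - real p ^ 2)"
  have "(\<Sum>k=1..<n. zeta_partial (2 * k) N * zeta_partial (2 * n - 2 * k) N) =
    (\<Sum>p=1..N. \<Sum>q=1..N. ?f p q)"
    unfolding zeta_partial_def sum_product
    by (subst sum.swap, rule sum.cong[OF refl], subst sum.swap) simp
  \<comment> \<open>On the diagonal \<open>?g p p\<close> is 0, because division by 0 yields 0, so
    the off-diagonal part can be summed over all q.\<close>
  also have "\<dots> = (\<Sum>p=1..N. \<Sum>q=1..N. (if p = q then (real n - 1) / real p ^ (2 * n) else 0) +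
     (?g p q + ?g q p))"
  proof (intro sum.cong refl)
    fix p q assume pq: "p \<in> {1..N}" "q \<in> {1..N}"
    show "?f p q = (if p = q then (real n - 1) / real p ^ (2 * n) else 0) + (?g p q + ?g q p)"
    proof (cases "p = q")
      case True
      have "?f p q = (\<Sum>k=1..<n. 1 / real p ^ (2 * n))"
        using True by (intro sum.cong) (auto simp: power_add[symmetric])
      then show ?thesis using True assms by (simp add: of_nat_diff)
    next
      case False
      have "real p ^ 2 - real q ^ 2 = - (real q ^ 2 - real p ^ 2)" by simp
      then have "?g q p = - (1 / real q ^ (2 * n - 2) / (real q ^ 2 - real p ^ 2))"
        by (metis divide_minus_right)
      then show ?thesis
        using False pq sum_inverse_powers_neq[of p q n] assms
        by (simp only: diff_divide_distrib) simp
    qed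
  qed
  also have "\<dots> = (\<Sum>p=1..N. (real n - 1) / real p ^ (2 * n)) +
      ((\<Sum>p=1..N. \<Sum>q=1..N. ?g p q) + (\<Sum>p=1..N. \<Sum>q=1..N. ?g q p))"
    by (simp add: sum.distrib)
  also have "(\<Sum>p=1..N. \<Sum>q=1..N. ?g q p) = (\<Sum>p=1..N. \<Sum>q=1..N. ?g p q)"
    by (rule sum.swap)
  also have "(\<Sum>p=1..N. \<Sum>q=1..N. ?g p q) =
     (\<Sum>p=1..N. 3 / 4 / real p ^ (2 * n) - (harm (N + p) - harm (N - p)) / real p ^ (2 * n - 1) / 2)"
  proof (rule sum.cong[OF refl])
    fix p assume p: "p \<in> {1..N}"
    obtain m where m: "n = Suc m" using assms by (cases n) auto
    have "(\<Sum>q=1..N. ?g p q) = (\<Sum>q\<in>{1..N} - {p}. ?g p q)"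
      by (rule sum.mono_neutral_right) auto
    also have "\<dots> = 1 / real p ^ (2 * n - 2) * (\<Sum>q\<in>{1..N} - {p}. 1 / (real q ^ 2 - real p ^ 2))"
      by (simp add: sum_distrib_left)
    also have "\<dots> = 3 / 4 / real p ^ (2 * n) - (harm (N + p) - harm (N - p)) / real p ^ (2 * n - 1) / 2"
      using p by (subst sum_inverse_diff_squares) (auto simp: m power2_eq_square field_simps)
    finally show "(\<Sum>q=1..N. ?g p q) = \<dots>" .
  qed
  also have "\<dots> = 3 / 4 * zeta_partial (2 * n) N -
     (\<Sum>p=1..N. (harm (N + p) - harm (N - p)) / real p ^ (2 * n - 1)) / 2"
    by (simp add: zeta_partial_def sum_subtractf sum_divide_distrib sum_distrib_left)
  also have "(\<Sum>p=1..N. (real n - 1) / real p ^ (2 * n)) = (real n - 1) * zeta_partial (2 * n) N"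
    by (simp add: zeta_partial_def sum_distrib_left)
  finally show ?thesis by (simp add: algebra_simps)
qed

text \<open>By \<open>harm_diff_le\<close> and p^s \<ge> p^2 each summand is at most 2/(N + 1) times
  1/p + 1/(N - p + 1). Summation gives the bound \<open>4 * harm N / (N + 1)\<close>, which tends to
  0 because harmonic numbers grow logarithmically.\<close>

lemma sum_harm_diff_tendsto_0:
  assumes "s \<ge> 3"
  shows "(\<lambda>N. \<Sum>p=1..N. (harm (N + p) - harm (N - p)) / real p ^ s) \<longlonglongrightarrow> 0"
proof (rule tendsto_sandwich[OF _ _ tendsto_const])
  show "eventually (\<lambda>N. 0 \<le> (\<Sum>p=1..N. (harm (N + p) - harm (N - p)) / real p ^ s)) sequentially"
    by (intro always_eventually allI sum_nonneg divide_nonneg_nonneg)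
      (auto intro!: harm_mono)
  have "(\<Sum>p=1..N. (harm (N + p) - harm (N - p)) / real p ^ s) \<le> 4 * harm N / (real N + 1)" for N
  proof -
    have "(\<Sum>p=1..N. (harm (N + p) - harm (N - p)) / real p ^ s) \<le>
       (\<Sum>p=1..N. 2 / (real N + 1) * (inverse (real p) + inverse (real N - real p + 1)))"
    proof (rule sum_mono)
      fix p assume p: "p \<in> {1..N}"
      have "(harm (N + p) - harm (N - p)) / real p ^ s
         \<le> (2 * real p / (real N - real p + 1)) / real p ^ 2"
        using p assms by (intro frac_le harm_diff_le power_increasing) auto
      also have "\<dots> = 2 / (real N + 1) * (inverse (real p) + inverse (real N - real p + 1))"
        using p by (simp add: power2_eq_square divide_simps)
      finally show "(harm (N + p) - harm (N - p)) / real p ^ s \<le> \<dots>" .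
    qed
    also have "\<dots> = 2 / (real N + 1) *
        ((\<Sum>p=1..N. inverse (real p)) + (\<Sum>p=1..N. inverse (real N - real p + 1)))"
      by (simp only: sum_distrib_left[symmetric] sum.distrib)
    also have "(\<Sum>p=1..N. inverse (real N - real p + 1)) = (\<Sum>p=1..N. inverse (real p))"
      by (rule sum.reindex_bij_witness[of _ "\<lambda>p. N + 1 - p" "\<lambda>p. N + 1 - p"])
        (auto simp: of_nat_diff)
    finally show ?thesis by (simp add: harm_def)
  qed
  then show "eventually (\<lambda>N. (\<Sum>p=1..N. (harm (N + p) - harm (N - p)) / real p ^ s)
      \<le> 4 * harm N / (real N + 1)) sequentially" by simp
  have "(\<lambda>N. harm N / real (Suc N) :: real) \<longlonglongrightarrow> 0"
  proof (rule tendsto_sandwich[OF _ _ tendsto_const])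
    show "eventually (\<lambda>N. 0 \<le> (harm N / real (Suc N) :: real)) sequentially"
      by (intro always_eventually allI divide_nonneg_nonneg harm_nonneg) auto
    show "eventually (\<lambda>N. harm N / real (Suc N) \<le> (harm N - ln (real N)) * (1 / real N) + ln (real N) / real N)
      sequentially"
    proof (rule eventually_mono[OF eventually_gt_at_top[of 0]])
      fix N :: nat assume "0 < N"
      then have "harm N / real (Suc N) \<le> harm N / real N"
        by (intro divide_left_mono harm_nonneg) auto
      then show "harm N / real (Suc N) \<le> (harm N - ln (real N)) * (1 / real N) + ln (real N) / real N"
        by (simp add: diff_divide_distrib)
    qed
    \<comment> \<open>\<open>harm N - ln N\<close> converges, to the Euler-Mascheroni constant, so
      both terms tend to 0.\<close>
    have "(\<lambda>N. (harm N - ln (real N)) * (1 / real N) + ln (real N) / real N)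
      \<longlonglongrightarrow> lim (\<lambda>n. harm n - ln (real n)) * 0 + 0"
      using euler_mascheroni_convergent
      by (intro tendsto_add tendsto_mult lim_ln_over_n lim_1_over_n) (simp add: convergent_LIMSEQ_iff)
    then show "(\<lambda>N. (harm N - ln (real N)) * (1 / real N) + ln (real N) / real N) \<longlonglongrightarrow> 0"
      by simp
  qed
  then have "(\<lambda>N. 4 * (harm N / real (Suc N)) :: real) \<longlonglongrightarrow> 4 * 0"
    by (intro tendsto_mult tendsto_const)
  then show "(\<lambda>N. 4 * harm N / (real N + 1) :: real) \<longlonglongrightarrow> 0" by (simp add: algebra_simps)
qed

text \<open>The limit of \<open>sum_zeta_partial_prod\<close>; \<open>n \<ge> 2\<close> makes the
  exponent 2n - 1 of the error term at least 3.\<close>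

theorem sum_zeta_even_prod:
  assumes "n \<ge> 2"
  shows "(\<Sum>k=1..<n. zeta (2 * k) * zeta (2 * n - 2 * k)) = (real n + 1 / 2) * zeta (2 * n)"
proof (rule LIMSEQ_unique)
  show "(\<lambda>N. \<Sum>k=1..<n. zeta_partial (2 * k) N * zeta_partial (2 * n - 2 * k) N)
     \<longlonglongrightarrow> (\<Sum>k=1..<n. zeta (2 * k) * zeta (2 * n - 2 * k))"
    by (intro tendsto_sum tendsto_mult zeta_partial_tendsto) auto
  have "(\<lambda>N. (real n + 1 / 2) * zeta_partial (2 * n) N -
    (\<Sum>p=1..N. (harm (N + p) - harm (N - p)) / real p ^ (2 * n - 1)))
    \<longlonglongrightarrow> (real n + 1 / 2) * zeta (2 * n) - 0"
    using assms
    by (intro tendsto_diff tendsto_mult tendsto_const zeta_partial_tendsto sum_harm_diff_tendsto_0) auto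
  then show "(\<lambda>N. \<Sum>k=1..<n. zeta_partial (2 * k) N * zeta_partial (2 * n - 2 * k) N)
     \<longlonglongrightarrow> (real n + 1 / 2) * zeta (2 * n)"
    using sum_zeta_partial_prod[OF assms] by simp
qed

section \<open>The generating function of the even zeta values\<close>

text \<open>Strong induction: for n \<ge> 2 Euler's identity expresses zeta(2n) by products of
  values at smaller even arguments 2k and 2n - 2k, and the powers of zeta(2) multiply to the
  n-th.\<close>

lemma zeta_even_rational_multiple:
  assumes "n \<ge> 1"
  shows "\<exists>q. zeta (2 * n) = real_of_rat q * zeta 2 ^ n"
  using assms
proof (induction n rule: less_induct)
  case (less n)
  show ?case
  proof (cases "n = 1")
    case True
    then show ?thesis by (intro exI[of _ 1]) simp
  next
    case False
    then have n: "n \<ge> 2" using less.prems by simp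
    have "\<forall>k\<in>{1..<n}. \<exists>q. zeta (2 * k) = real_of_rat q * zeta 2 ^ k"
      using less.IH by auto
    then obtain q where q: "\<And>k. k \<in> {1..<n} \<Longrightarrow> zeta (2 * k) = real_of_rat (q k) * zeta 2 ^ k"
      by metis
    have "zeta (2 * n) = (\<Sum>k=1..<n. zeta (2 * k) * zeta (2 * n - 2 * k)) / (real n + 1 / 2)"
      using sum_zeta_even_prod[OF n] by (simp add: field_simps)
    also have "(\<Sum>k=1..<n. zeta (2 * k) * zeta (2 * n - 2 * k)) =
        (\<Sum>k=1..<n. real_of_rat (q k * q (n - k)) * zeta 2 ^ n)"
    proof (rule sum.cong[OF refl])
      fix k assume k: "k \<in> {1..<n}"
      then have zn: "zeta 2 ^ n = zeta 2 ^ k * zeta 2 ^ (n - k)"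
        by (simp add: power_add[symmetric])
      have "zeta (2 * n - 2 * k) = real_of_rat (q (n - k)) * zeta 2 ^ (n - k)"
        using q[of "n - k"] k by (auto simp: diff_mult_distrib2)
      with q[OF k] show
          "zeta (2 * k) * zeta (2 * n - 2 * k) = real_of_rat (q k * q (n - k)) * zeta 2 ^ n"
        by (simp only: of_rat_mult zn ac_simps)
    qed
    also have "\<dots> / (real n + 1 / 2) =
        real_of_rat ((\<Sum>k=1..<n. q k * q (n - k)) / (of_nat n + 1 / 2)) * zeta 2 ^ n"
      by (simp add: of_rat_divide of_rat_add of_rat_sum sum_distrib_right)
    finally show ?thesis by blast
  qed
qed

text \<open>
  The value at \<open>0\<close> is chosen so that the generating function has no constant term; it is
  not the one coming from \<open>\<zeta>(0) = -1/2\<close>.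
\<close>

definition zeta_ratio :: "nat \<Rightarrow> rat" where
  "zeta_ratio n = (if n = 0 then 0 else SOME q. zeta (2 * n) = real_of_rat q * zeta 2 ^ n)"

lemma zeta_ratio_0 [simp]: "zeta_ratio 0 = 0"
  by (simp add: zeta_ratio_def)

lemma zeta_even_eq:
  assumes "n \<ge> 1"
  shows "zeta (2 * n) = real_of_rat (zeta_ratio n) * zeta 2 ^ n"
  using someI_ex[OF zeta_even_rational_multiple[OF assms]] assms by (simp add: zeta_ratio_def)

lemma zeta_ratio_unique:
  assumes "n \<ge> 1" "real_of_rat q * zeta 2 ^ n = zeta (2 * n)"
  shows "zeta_ratio n = q"
  using assms zeta_even_eq[of n] zeta_pos[of 2] by simp

lemma zeta_ratio_1 [simp]: "zeta_ratio (Suc 0) = 1"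
  by (rule zeta_ratio_unique) simp_all

text \<open>Permits the division by \<open>zeta_ratio k\<close> with which
  \<open>representable_imp_zeta\<close> restores the factor zeta(2k).\<close>

lemma zeta_ratio_nonzero:
  assumes "n \<ge> 1"
  shows "zeta_ratio n \<noteq> 0"
  using zeta_pos[of "2 * n"] zeta_even_eq[OF assms] assms by auto

lemma zeta_ratio_recurrence:
  assumes "n \<ge> 2"
  shows "(\<Sum>k=1..<n. zeta_ratio k * zeta_ratio (n - k)) = (of_nat n + 1 / 2) * zeta_ratio n"
proof -
  let ?S = "\<Sum>k=1..<n. zeta_ratio k * zeta_ratio (n - k)"
  have "zeta_ratio n = ?S / (of_nat n + 1 / 2)"
  proof (rule zeta_ratio_unique)
    have "real_of_rat ?S * zeta 2 ^ n = (\<Sum>k=1..<n. zeta (2 * k) * zeta (2 * n - 2 * k))"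
      unfolding of_rat_sum sum_distrib_right
    proof (rule sum.cong[OF refl])
      fix k assume k: "k \<in> {1..<n}"
      then have zn: "zeta 2 ^ n = zeta 2 ^ k * zeta 2 ^ (n - k)"
        by (simp add: power_add[symmetric])
      have "zeta (2 * n - 2 * k) = real_of_rat (zeta_ratio (n - k)) * zeta 2 ^ (n - k)"
        using zeta_even_eq[of "n - k"] k by (auto simp: diff_mult_distrib2)
      moreover have "zeta (2 * k) = real_of_rat (zeta_ratio k) * zeta 2 ^ k"
        using zeta_even_eq[of k] k by auto
      ultimately show "real_of_rat (zeta_ratio k * zeta_ratio (n - k)) * zeta 2 ^ n =
          zeta (2 * k) * zeta (2 * n - 2 * k)"
        by (simp only: of_rat_mult zn ac_simps)
    qed
    also have "\<dots> = (real n + 1 / 2) * zeta (2 * n)" by (rule sum_zeta_even_prod[OF assms])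
    finally have "real_of_rat ?S * zeta 2 ^ n = (real n + 1 / 2) * zeta (2 * n)" .
    moreover have "real n + 1 / 2 \<noteq> 0" by linarith
    ultimately show "real_of_rat (?S / (of_nat n + 1 / 2)) * zeta 2 ^ n = zeta (2 * n)"
      by (simp add: of_rat_divide of_rat_add)
  qed (use assms in auto)
  moreover have "(of_nat n + 1 / 2 :: rat) \<noteq> 0"
    by (metis add_nonneg_pos of_nat_0_le_iff order_less_irrefl zero_less_divide_1_iff zero_less_numeral)
  ultimately show ?thesis by simp
qed

section \<open>The differential equation of the generating function\<close>

abbreviation \<theta> :: "rat fps \<Rightarrow> rat fps" where
  "\<theta> P \<equiv> fps_X * fps_deriv P"

lemma theta_nth: "\<theta> P $ n = of_nat n * P $ n"
  by (cases n) (simp_all add: fps_X_mult_nth)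

lemma theta_mult: "\<theta> (P * Q) = \<theta> P * Q + P * \<theta> Q"
  by (simp add: algebra_simps)

definition zeta_fps :: "rat fps" where
  "zeta_fps = Abs_fps zeta_ratio"

lemma zeta_fps_nth [simp]: "zeta_fps $ n = zeta_ratio n"
  by (simp add: zeta_fps_def)

lemma theta_iter_nth: "(\<theta> ^^ j) P $ n = of_nat n ^ j * P $ n"
  by (induction j) (simp_all add: theta_nth del: fps_mult_fps_X_deriv_shift)

text \<open>From n = 2 on the coefficients encode \<open>zeta_ratio_recurrence\<close>. The term
  3X/2 is forced by the coefficient of X, where 1 = -1/2 + 3/2.\<close>

lemma theta_zeta_fps:
  "\<theta> zeta_fps = zeta_fps ^ 2 - fps_const (1 / 2) * zeta_fps + fps_const (3 / 2) * fps_X"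
proof (rule fps_ext)
  fix n :: nat
  consider "n = 0" | "n = 1" | "n \<ge> 2" by linarith
  then show "\<theta> zeta_fps $ n =
    (zeta_fps ^ 2 - fps_const (1 / 2) * zeta_fps + fps_const (3 / 2) * fps_X) $ n"
  proof cases
    case 3
    have "(zeta_fps ^ 2) $ n = (\<Sum>k=0..n. zeta_ratio k * zeta_ratio (n - k))"
      by (simp add: power2_eq_square fps_mult_nth)
    \<comment> \<open>The terms k = 0 and k = n vanish because
      \<open>zeta_ratio 0 = 0\<close>.\<close>
    also have "\<dots> = (\<Sum>k=1..<n. zeta_ratio k * zeta_ratio (n - k))"
      by (rule sum.mono_neutral_right) (auto simp: not_le not_less Suc_le_eq dest: le_antisym)
    also have "\<dots> = (of_nat n + 1 / 2) * zeta_ratio n"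
      by (rule zeta_ratio_recurrence[OF 3])
    finally show ?thesis
      using 3 unfolding theta_nth by (simp add: fps_X_def algebra_simps)
  qed (simp_all add: theta_nth power2_eq_square fps_mult_nth)
qed

lemma theta_zeta_fps_power:
  "\<theta> (zeta_fps ^ Suc m) = fps_const (of_nat (Suc m)) * (\<theta> zeta_fps * zeta_fps ^ m)"
  by (simp only: fps_deriv_power diff_Suc_1 ac_simps)

lemma theta_X_power: "\<theta> (fps_X ^ i) = fps_const (of_nat i) * fps_X ^ i"
  by (rule fps_ext) (simp add: theta_nth fps_X_power_iff)

text \<open>Rational scalars act through \<open>fps_const\<close>; this supplies the spans that
  define the filtrations and induction over them.\<close>

interpretation fps_module: module "\<lambda>c (P :: rat fps). fps_const c * P"
  by unfold_locales (simp_all add: algebra_simps flip: fps_const_add fps_const_mult)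

section \<open>Weight filtrations\<close>

lemma span_mult:
  assumes "P \<in> fps_module.span A" "Q \<in> fps_module.span B"
    and "\<And>a b. a \<in> A \<Longrightarrow> b \<in> B \<Longrightarrow> a * b \<in> fps_module.span C"
  shows "P * Q \<in> fps_module.span C"
  using assms(1)
proof (induction rule: fps_module.span_induct_alt)
  case base
  then show ?case by (simp add: fps_module.span_zero)
next
  case (step c a P)
  have "a * Q \<in> fps_module.span C"
    using assms(2)
  proof (induction rule: fps_module.span_induct_alt)
    case base
    then show ?case by (simp add: fps_module.span_zero)
  next
    case (step c b Q)
    then have "fps_const c * (a * b) + a * Q \<in> fps_module.span C"
      by (intro fps_module.span_add[OF fps_module.span_scale[OF assms(3)]] \<open>a \<in> A\<close>)
    then show ?case by (simp add: algebra_simps)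
  qed
  with step have "fps_const c * (a * Q) + P * Q \<in> fps_module.span C"
    by (intro fps_module.span_add fps_module.span_scale)
  then show ?case by (simp add: algebra_simps)
qed

lemma span_theta:
  assumes "P \<in> fps_module.span A" and "\<And>a. a \<in> A \<Longrightarrow> \<theta> a \<in> fps_module.span B"
  shows "\<theta> P \<in> fps_module.span B"
  using assms(1)
proof (induction rule: fps_module.span_induct_alt)
  case base
  then show ?case by (simp add: fps_module.span_zero)
next
  case (step c a P)
  then have "fps_const c * \<theta> a + \<theta> P \<in> fps_module.span B"
    by (intro fps_module.span_add[OF fps_module.span_scale[OF assms(2)]])
  then show ?case by (simp add: algebra_simps)
qed

definition weight_space :: "nat \<Rightarrow> rat fps set" where
  "weight_space w = fps_module.span {fps_X ^ i * zeta_fps ^ m | i m. 2 * i + m \<le> w}"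

text \<open>
  The elements of weight at most \<open>w + 2\<close> whose part of weight \<open>w + 2\<close> is divisible by that of
  \<open>\<theta> zeta_fps\<close>.
\<close>

definition deriv_weight_space :: "nat \<Rightarrow> rat fps set" where
  "deriv_weight_space w = fps_module.span
     ({\<theta> zeta_fps * (fps_X ^ i * zeta_fps ^ m) | i m. 2 * i + m \<le> w} \<union>
      {fps_X ^ i * zeta_fps ^ m | i m. 2 * i + m \<le> Suc w})"

lemma weight_space_base:
  assumes "2 * i + m \<le> w"
  shows "fps_X ^ i * zeta_fps ^ m \<in> weight_space w"
  unfolding weight_space_def using assms by (intro fps_module.span_base) blast

lemma zeta_fps_in_weight_space: "zeta_fps \<in> weight_space (Suc 0)"
  using weight_space_base[of 0 1] by simp

lemma weight_space_mult:
  assumes "P \<in> weight_space a" "Q \<in> weight_space b"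
  shows "P * Q \<in> weight_space (a + b)"
  using assms unfolding weight_space_def[of a] weight_space_def[of b]
  unfolding weight_space_def[of "a + b"]
proof (rule span_mult, fold weight_space_def)
  fix p q assume "p \<in> {fps_X ^ i * zeta_fps ^ m | i m. 2 * i + m \<le> a}"
    "q \<in> {fps_X ^ i * zeta_fps ^ m | i m. 2 * i + m \<le> b}"
  then obtain i m j k where "p = fps_X ^ i * zeta_fps ^ m" "q = fps_X ^ j * zeta_fps ^ k"
     "2 * i + m \<le> a" "2 * j + k \<le> b" by blast
  then show "p * q \<in> weight_space (a + b)"
    using weight_space_base[of "i + j" "m + k" "a + b"] by (simp add: power_add ac_simps)
qed

lemma deriv_weight_space_base1:
  assumes "2 * i + m \<le> w"
  shows "\<theta> zeta_fps * (fps_X ^ i * zeta_fps ^ m) \<in> deriv_weight_space w"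
  unfolding deriv_weight_space_def using assms by (intro fps_module.span_base) blast

lemma deriv_weight_space_base2:
  assumes "2 * i + m \<le> Suc w"
  shows "fps_X ^ i * zeta_fps ^ m \<in> deriv_weight_space w"
  unfolding deriv_weight_space_def using assms by (intro fps_module.span_base) blast

text \<open>\<theta>(X^i H^m) is i X^i H^m plus m X^i H^(m-1) \<theta> H. The first term keeps
  weight at most w + 1, and the second is a multiple of \<theta> H with cofactor of weight at most
  w.\<close>

lemma theta_weight_space:
  assumes "P \<in> weight_space (Suc w)"
  shows "\<theta> P \<in> deriv_weight_space w"
  using assms unfolding weight_space_def deriv_weight_space_def
proof (rule span_theta, fold deriv_weight_space_def)
  fix p assume "p \<in> {fps_X ^ i * zeta_fps ^ m | i m. 2 * i + m \<le> Suc w}"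
  then obtain i m where p: "p = fps_X ^ i * zeta_fps ^ m" "2 * i + m \<le> Suc w" by blast
  have "\<theta> p = fps_const (of_nat i) * p + fps_X ^ i * \<theta> (zeta_fps ^ m)"
    unfolding p(1) theta_mult theta_X_power by (simp add: mult.assoc)
  moreover have "fps_X ^ i * \<theta> (zeta_fps ^ m) \<in> deriv_weight_space w"
  proof (cases m)
    case 0
    then show ?thesis by (simp add: deriv_weight_space_def fps_module.span_zero)
  next
    case (Suc k)
    have "fps_const (of_nat m) * (\<theta> zeta_fps * (fps_X ^ i * zeta_fps ^ k)) \<in> deriv_weight_space w"
      using deriv_weight_space_base1[of i k w] p(2) Suc
      unfolding deriv_weight_space_def by (intro fps_module.span_scale) simp
    then show ?thesis unfolding Suc theta_zeta_fps_power by (simp only: ac_simps)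
  qed
  moreover have "p \<in> deriv_weight_space w"
    using deriv_weight_space_base2 p by simp
  ultimately show "\<theta> p \<in> deriv_weight_space w"
    unfolding deriv_weight_space_def
    by (simp only: fps_module.span_add fps_module.span_scale)
qed

lemma deriv_weight_space_subset: "deriv_weight_space w \<subseteq> weight_space (w + 2)"
proof -
  \<comment> \<open>Read off from the differential equation, since H^2, H and X have weight at most
    2.\<close>
  have *: "\<theta> zeta_fps \<in> weight_space 2"
    using weight_space_base[of 0 2 2] weight_space_base[of 0 1 2] weight_space_base[of 1 0 2]
    unfolding theta_zeta_fps weight_space_def
    by (intro fps_module.span_add fps_module.span_diff fps_module.span_scale) simp_all
  have "\<theta> zeta_fps * (fps_X ^ i * zeta_fps ^ m) \<in> weight_space (w + 2)" if "2 * i + m \<le> w" for i m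
    using weight_space_mult[OF * weight_space_base[OF that]] by (simp add: add.commute)
  moreover have "fps_X ^ i * zeta_fps ^ m \<in> weight_space (w + 2)" if "2 * i + m \<le> Suc w" for i m
    using that by (intro weight_space_base) simp
  ultimately show ?thesis
    unfolding deriv_weight_space_def weight_space_def[of "w + 2"]
    by (intro fps_module.span_minimal) (auto simp only: fps_module.subspace_span)
qed

text \<open>Divisibility of the top-weight part by that of \<theta> H is inherited by products, as
  in an ideal. One differentiated factor is therefore enough.\<close>

lemma deriv_weight_space_mult:
  assumes "P \<in> weight_space a" "Q \<in> deriv_weight_space b"
  shows "P * Q \<in> deriv_weight_space (a + b)"
  using assms unfolding weight_space_def deriv_weight_space_def[of b]
  unfolding deriv_weight_space_def[of "a + b"]
proof (rule span_mult, fold deriv_weight_space_def)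
  fix p q assume "p \<in> {fps_X ^ i * zeta_fps ^ m | i m. 2 * i + m \<le> a}"
    "q \<in> {\<theta> zeta_fps * (fps_X ^ i * zeta_fps ^ m) | i m. 2 * i + m \<le> b} \<union>
      {fps_X ^ i * zeta_fps ^ m | i m. 2 * i + m \<le> Suc b}"
  then obtain i m j k where p: "p = fps_X ^ i * zeta_fps ^ m" "2 * i + m \<le> a"
    and "(q = \<theta> zeta_fps * (fps_X ^ j * zeta_fps ^ k) \<and> 2 * j + k \<le> b) \<or>
      (q = fps_X ^ j * zeta_fps ^ k \<and> 2 * j + k \<le> Suc b)" by blast
  then show "p * q \<in> deriv_weight_space (a + b)"
  proof (elim disjE conjE)
    assume "q = \<theta> zeta_fps * (fps_X ^ j * zeta_fps ^ k)" "2 * j + k \<le> b"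
    then show ?thesis
      using p deriv_weight_space_base1[of "i + j" "m + k" "a + b"]
      by (simp add: power_add ac_simps)
  next
    assume "q = fps_X ^ j * zeta_fps ^ k" "2 * j + k \<le> Suc b"
    then show ?thesis
      using p deriv_weight_space_base2[of "i + j" "m + k" "a + b"]
      by (simp add: power_add ac_simps)
  qed
qed

lemma theta_iter_in_weight_space: "(\<theta> ^^ a) zeta_fps \<in> weight_space (Suc a)"
proof (induction a)
  case 0
  then show ?case by (simp add: zeta_fps_in_weight_space)
next
  case (Suc a)
  then show ?case
    using theta_weight_space deriv_weight_space_subset[of a] by auto
qed

lemma theta_iter_in_deriv_weight_space: "(\<theta> ^^ Suc a) zeta_fps \<in> deriv_weight_space a"
  using theta_weight_space[OF theta_iter_in_weight_space[of a]] by simp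

text \<open>The target of the reduction: the n-th coefficient of X^i \<theta>^j H is (n - i)^j
  \<open>zeta_ratio (n - i)\<close>, and a pure power of X affects a single coefficient. The first
  inequality with w is strict because X^i \<theta>^j H has weight 2i + j + 1.\<close>

definition zeta_space :: "nat \<Rightarrow> nat \<Rightarrow> rat fps set" where
  "zeta_space T w = fps_module.span
     ({fps_X ^ i * (\<theta> ^^ j) zeta_fps | i j. i \<le> T \<and> 2 * i + j < w} \<union> {fps_X ^ i | i. 2 * i \<le> w})"

lemma zeta_space_base1:
  assumes "i \<le> T" "2 * i + j < w"
  shows "fps_X ^ i * (\<theta> ^^ j) zeta_fps \<in> zeta_space T w"
  unfolding zeta_space_def using assms by (intro fps_module.span_base) blast

lemma zeta_space_base2:
  assumes "2 * i \<le> w"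
  shows "fps_X ^ i \<in> zeta_space T w"
  unfolding zeta_space_def using assms by (intro fps_module.span_base) blast

lemma zeta_space_lincomb:
  assumes "P \<in> zeta_space T w" "Q \<in> zeta_space T w"
  shows "P + Q \<in> zeta_space T w" "P - Q \<in> zeta_space T w"
  using assms unfolding zeta_space_def
  by (simp_all only: fps_module.span_add fps_module.span_diff)

lemma zeta_space_scale:
  assumes "P \<in> zeta_space T w"
  shows "fps_const c * P \<in> zeta_space T w"
  using assms unfolding zeta_space_def by (rule fps_module.span_scale)

lemma zeta_space_mono:
  assumes "T \<le> T'" "w \<le> w'"
  shows "zeta_space T w \<subseteq> zeta_space T' w'"
  unfolding zeta_space_def using assms by (intro fps_module.span_mono) fastforce

text \<open>\<open>2 * i + j < w\<close> and \<open>w \<le> 2 * T + 2\<close> force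
  \<open>i \<le> T\<close>, so here the weight alone controls the powers of X.\<close>

lemma zeta_space_restrict:
  assumes "w \<le> 2 * T + 2"
  shows "zeta_space T' w \<subseteq> zeta_space T w"
  unfolding zeta_space_def using assms by (intro fps_module.span_mono) fastforce

text \<open>Differentiation raises j by one but leaves i alone: the weight grows while the bound T
  on the powers of X survives.\<close>

lemma zeta_space_theta:
  assumes "P \<in> zeta_space T w"
  shows "\<theta> P \<in> zeta_space T (Suc w)"
  using assms unfolding zeta_space_def
proof (rule span_theta, fold zeta_space_def)
  fix p assume "p \<in> {fps_X ^ i * (\<theta> ^^ j) zeta_fps | i j. i \<le> T \<and> 2 * i + j < w} \<union>
    {fps_X ^ i | i. 2 * i \<le> w}"
  then consider i j where "p = fps_X ^ i * (\<theta> ^^ j) zeta_fps" "i \<le> T" "2 * i + j < w"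
    | i where "p = fps_X ^ i" "2 * i \<le> w" by blast
  then show "\<theta> p \<in> zeta_space T (Suc w)"
  proof cases
    case 1
    have "\<theta> p = fps_const (of_nat i) * p + fps_X ^ i * (\<theta> ^^ Suc j) zeta_fps"
      unfolding 1(1) theta_mult theta_X_power by (simp add: mult.assoc)
    moreover have "p \<in> zeta_space T (Suc w)" "fps_X ^ i * (\<theta> ^^ Suc j) zeta_fps \<in> zeta_space T (Suc w)"
      unfolding 1(1) using 1 by (auto intro!: zeta_space_base1 simp del: funpow.simps)
    ultimately show ?thesis by (simp only: zeta_space_lincomb zeta_space_scale)
  next
    case 2
    then show ?thesis
      unfolding 2(1) theta_X_power by (intro zeta_space_scale zeta_space_base2) simp
  qed
qed

lemma zeta_space_X:
  assumes "P \<in> zeta_space T w"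
  shows "fps_X ^ k * P \<in> zeta_space (T + k) (w + 2 * k)"
proof -
  have "fps_X ^ k \<in> fps_module.span {fps_X ^ k}" by (intro fps_module.span_base) simp
  then show ?thesis
    using assms unfolding zeta_space_def
  proof (rule span_mult, fold zeta_space_def)
    fix a b :: "rat fps"
    assume a: "a \<in> {fps_X ^ k}" and "b \<in> {fps_X ^ i * (\<theta> ^^ j) zeta_fps | i j. i \<le> T \<and> 2 * i + j < w} \<union>
      {fps_X ^ i | i. 2 * i \<le> w}"
    then consider i j where "b = fps_X ^ i * (\<theta> ^^ j) zeta_fps" "i \<le> T" "2 * i + j < w"
      | i where "b = fps_X ^ i" "2 * i \<le> w" by blast
    then show "a * b \<in> zeta_space (T + k) (w + 2 * k)"
    proof cases
      case 1
      then show ?thesis using a zeta_space_base1[of "i + k" "T + k" j "w + 2 * k"]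
        by (simp add: power_add ac_simps)
    next
      case 2
      then show ?thesis using a zeta_space_base2[of "i + k" "w + 2 * k"]
        by (simp add: power_add ac_simps)
    qed
  qed
qed

text \<open>The differential equation turns \<theta>(H^(m+1)) = (m+1) H^m \<theta> H into a formula
  for H^(m+2) in terms of \<theta>(H^(m+1)), H^(m+1) and X H^m, hence the two-step induction. The
  bound m on the powers of X is crude and is sharpened by
  \<open>zeta_space_restrict\<close>.\<close>

lemma zeta_fps_power_in_zeta_space: "zeta_fps ^ m \<in> zeta_space m m"
proof (induction m rule: induct_nat_012)
  case 0
  then show ?case using zeta_space_base2[of 0 0 0] by simp
next
  case 1
  then show ?case using zeta_space_base1[of 0 1 0 1] by simp
next
  case (ge2 m)
  have "fps_const (inverse (of_nat (Suc m))) * \<theta> (zeta_fps ^ Suc m) = \<theta> zeta_fps * zeta_fps ^ m"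
    unfolding theta_zeta_fps_power
    by (simp only: mult.assoc[symmetric] fps_const_mult) (simp del: of_nat_Suc)
  also have "\<dots> = zeta_fps ^ Suc (Suc m) - fps_const (1 / 2) * zeta_fps ^ Suc m +
      fps_const (3 / 2) * (fps_X ^ 1 * zeta_fps ^ m)"
    unfolding theta_zeta_fps by (simp add: algebra_simps power2_eq_square)
  finally have "zeta_fps ^ Suc (Suc m) =
      fps_const (inverse (of_nat (Suc m))) * \<theta> (zeta_fps ^ Suc m) +
      fps_const (1 / 2) * zeta_fps ^ Suc m - fps_const (3 / 2) * (fps_X ^ 1 * zeta_fps ^ m)"
    by (simp only: algebra_simps)
  moreover have "\<theta> (zeta_fps ^ Suc m) \<in> zeta_space (Suc (Suc m)) (Suc (Suc m))"
    using zeta_space_theta[OF ge2(2)]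
      zeta_space_mono[of "Suc m" "Suc (Suc m)" "Suc (Suc m)" "Suc (Suc m)"] by auto
  moreover have "zeta_fps ^ Suc m \<in> zeta_space (Suc (Suc m)) (Suc (Suc m))"
    using ge2(2) zeta_space_mono[of "Suc m" "Suc (Suc m)" "Suc m" "Suc (Suc m)"] by auto
  moreover have "fps_X ^ 1 * zeta_fps ^ m \<in> zeta_space (Suc (Suc m)) (Suc (Suc m))"
    using zeta_space_X[OF ge2(1), of 1] zeta_space_mono[of "Suc m" "Suc (Suc m)" "Suc (Suc m)"] by auto
  ultimately show ?case by (simp only: zeta_space_lincomb zeta_space_scale)
qed

lemma weight_space_subset_zeta_space:
  assumes "w \<le> 2 * T + 2"
  shows "weight_space w \<subseteq> zeta_space T w"
proof -
  have "fps_X ^ i * zeta_fps ^ m \<in> zeta_space T w" if "2 * i + m \<le> w" for i m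
  proof -
    have "fps_X ^ i * zeta_fps ^ m \<in> zeta_space (m + i) (m + 2 * i)"
      by (intro zeta_space_X zeta_fps_power_in_zeta_space)
    also have "\<dots> \<subseteq> zeta_space (m + i) w" using that by (intro zeta_space_mono) auto
    also have "\<dots> \<subseteq> zeta_space T w" using assms by (rule zeta_space_restrict)
    finally show ?thesis .
  qed
  then show ?thesis
    unfolding weight_space_def zeta_space_def
    by (intro fps_module.span_minimal) (auto simp only: fps_module.subspace_span)
qed

text \<open>Here the weight w + 2 may exceed 2T + 2 by one. Up to the factor m + 1, the product of
  \<theta> H and X^i H^m is \<theta> P - i P with P = X^i H^(m+1). This P has weight at most w + 1,
  so it is covered by \<open>weight_space_subset_zeta_space\<close>, and \<theta> does not raise
  powers of X.\<close>

lemma deriv_weight_space_subset_zeta_space: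
  assumes "Suc w \<le> 2 * T + 2"
  shows "deriv_weight_space w \<subseteq> zeta_space T (w + 2)"
proof -
  have sub: "weight_space (Suc w) \<subseteq> zeta_space T (Suc w)"
    using assms by (rule weight_space_subset_zeta_space)
  have base: "fps_X ^ i * zeta_fps ^ m \<in> zeta_space T (w + 2)" if "2 * i + m \<le> Suc w" for i m
    using sub weight_space_base[OF that] zeta_space_mono[of T T "Suc w" "w + 2"] by auto
  have "\<theta> zeta_fps * (fps_X ^ i * zeta_fps ^ m) \<in> zeta_space T (w + 2)"
    if im: "2 * i + m \<le> w" for i m
  proof -
    define P where "P = fps_X ^ i * zeta_fps ^ Suc m"
    have "\<theta> P = fps_const (of_nat i) * P +
        fps_const (of_nat (Suc m)) * (\<theta> zeta_fps * (fps_X ^ i * zeta_fps ^ m))"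
      unfolding P_def theta_mult theta_X_power theta_zeta_fps_power by (simp only: ac_simps)
    then have "fps_const (inverse (of_nat (Suc m))) * (\<theta> P - fps_const (of_nat i) * P) =
       fps_const (inverse (of_nat (Suc m))) *
         (fps_const (of_nat (Suc m)) * (\<theta> zeta_fps * (fps_X ^ i * zeta_fps ^ m)))"
      by simp
    also have "\<dots> = \<theta> zeta_fps * (fps_X ^ i * zeta_fps ^ m)"
      by (simp only: mult.assoc[symmetric] fps_const_mult) (simp del: of_nat_Suc)
    finally have "\<theta> zeta_fps * (fps_X ^ i * zeta_fps ^ m) =
        fps_const (inverse (of_nat (Suc m))) * (\<theta> P - fps_const (of_nat i) * P)" ..
    moreover have "P \<in> zeta_space T (w + 2)" unfolding P_def using im by (intro base) simp
    moreover have "\<theta> P \<in> zeta_space T (w + 2)"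
      using zeta_space_theta[of P T "Suc w"] sub weight_space_base[of i "Suc m" "Suc w"] im
      by (auto simp: P_def)
    ultimately show ?thesis by (simp only: zeta_space_lincomb zeta_space_scale)
  qed
  with base show ?thesis
    unfolding deriv_weight_space_def zeta_space_def
    by (intro fps_module.span_minimal) (auto simp only: fps_module.subspace_span)
qed

section \<open>Sequences representable by zeta values\<close>

text \<open>The right-hand side of the theorem after division by zeta(2)^n, with the rational part
  of zeta(2k) absorbed into \<open>C k\<close>.\<close>

definition zeta_representable :: "nat \<Rightarrow> nat \<Rightarrow> (nat \<Rightarrow> rat) \<Rightarrow> bool" where
  "zeta_representable d T f \<longleftrightarrow> (\<exists>C :: nat \<Rightarrow> rat poly.
     (\<forall>k\<le>T. degree (C k) \<le> d + 2) \<and>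
     (\<forall>n\<ge>d + 2. f n = (\<Sum>k=0..T. poly (C k) (of_nat n) * zeta_ratio (n - k))))"

lemma zeta_representable_zero: "zeta_representable d T (\<lambda>n. 0)"
  unfolding zeta_representable_def by (intro exI[of _ "\<lambda>_. 0"]) simp

lemma zeta_representable_add:
  assumes "zeta_representable d T f" "zeta_representable d T g"
  shows "zeta_representable d T (\<lambda>n. f n + g n)"
proof -
  obtain C D where "\<forall>k\<le>T. degree (C k) \<le> d + 2"
      "\<forall>n\<ge>d + 2. f n = (\<Sum>k=0..T. poly (C k) (of_nat n) * zeta_ratio (n - k))"
      "\<forall>k\<le>T. degree (D k) \<le> d + 2"
      "\<forall>n\<ge>d + 2. g n = (\<Sum>k=0..T. poly (D k) (of_nat n) * zeta_ratio (n - k))"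
    using assms unfolding zeta_representable_def by blast
  then show ?thesis
    unfolding zeta_representable_def
    by (intro exI[of _ "\<lambda>k. C k + D k"]) (auto intro: degree_add_le simp: algebra_simps sum.distrib)
qed

lemma zeta_representable_scale:
  assumes "zeta_representable d T f"
  shows "zeta_representable d T (\<lambda>n. c * f n)"
proof -
  obtain C where "\<forall>k\<le>T. degree (C k) \<le> d + 2"
      "\<forall>n\<ge>d + 2. f n = (\<Sum>k=0..T. poly (C k) (of_nat n) * zeta_ratio (n - k))"
    using assms unfolding zeta_representable_def by blast
  then show ?thesis
    unfolding zeta_representable_def
    by (intro exI[of _ "\<lambda>k. smult c (C k)"])
      (auto intro: order.trans[OF degree_smult_le] simp: sum_distrib_left mult.assoc)
qed

lemma zeta_representable_sum:
  assumes "\<And>x. x \<in> A \<Longrightarrow> zeta_representable d T (f x)"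
  shows "zeta_representable d T (\<lambda>n. \<Sum>x\<in>A. f x n)"
  using assms
  by (induction A rule: infinite_finite_induct)
    (simp_all add: zeta_representable_zero zeta_representable_add)

lemma zeta_representable_cong:
  assumes "zeta_representable d T f" "\<And>n. n \<ge> d + 2 \<Longrightarrow> f n = g n"
  shows "zeta_representable d T g"
  using assms unfolding zeta_representable_def by simp

lemma zeta_representable_poly:
  assumes "degree p \<le> d + 2"
  shows "zeta_representable d T (\<lambda>n. poly p (of_nat n) * zeta_ratio n)"
  unfolding zeta_representable_def
proof (intro exI[of _ "\<lambda>k. if k = 0 then p else 0"] conjI allI impI)
  fix n
  have "(\<Sum>k=0..T. poly (if k = 0 then p else 0) (of_nat n) * zeta_ratio (n - k)) =
     (\<Sum>k=0..T. if k = 0 then poly p (of_nat n) * zeta_ratio n else 0)"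
    by (rule sum.cong) auto
  then show "poly p (of_nat n) * zeta_ratio n =
     (\<Sum>k=0..T. poly (if k = 0 then p else 0) (of_nat n) * zeta_ratio (n - k))" by simp
qed (use assms in auto)

text \<open>X^i \<theta>^j H contributes the polynomial (n - i)^j, of degree j \<le> d + 2, at k =
  i. A pure power X^i contributes nothing, since 2i \<le> d + 3 forces i < d + 2 \<le> n.\<close>

lemma zeta_space_representable:
  assumes "P \<in> zeta_space T (d + 3)" "T \<le> d + 2"
  shows "zeta_representable d T (\<lambda>n. P $ n)"
  using assms(1) unfolding zeta_space_def
proof (induction rule: fps_module.span_induct_alt)
  case base
  then show ?case by (simp add: zeta_representable_zero)
next
  case (step c p P)
  have "zeta_representable d T (\<lambda>n. p $ n)"
    using step(1)
  proof (elim UnE CollectE exE conjE)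
    fix i j assume ij: "p = fps_X ^ i * (\<theta> ^^ j) zeta_fps" "i \<le> T" "2 * i + j < d + 3"
    show ?thesis
      unfolding zeta_representable_def
    proof (intro exI[of _ "\<lambda>k. if k = i then [:- of_nat i, 1:] ^ j else 0"] conjI allI impI)
      fix n assume "d + 2 \<le> n"
      then have "i \<le> n" using ij assms(2) by simp
      have "(\<Sum>k=0..T. poly (if k = i then [:- of_nat i, 1:] ^ j else 0) (of_nat n) * zeta_ratio (n - k))
         = (\<Sum>k=0..T. if k = i then (of_nat n - of_nat i) ^ j * zeta_ratio (n - i) else 0)"
        by (rule sum.cong) (auto simp: poly_power)
      also have "\<dots> = (of_nat n - of_nat i) ^ j * zeta_ratio (n - i)"
        using ij by simp
      finally show "p $ n = (\<Sum>k=0..T. poly (if k = i then [:- of_nat i, 1:] ^ j else 0) (of_nat n)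
          * zeta_ratio (n - k))"
        using \<open>i \<le> n\<close> unfolding ij(1) fps_X_power_mult_nth theta_iter_nth by (simp add: of_nat_diff)
    next
      fix k
      have "degree ([:- of_nat i, 1 :: rat:] ^ j) \<le> j"
        using degree_power_le[of "[:- of_nat i, 1 :: rat:]" j] by simp
      then show "degree (if k = i then [:- of_nat i, 1 :: rat:] ^ j else 0) \<le> d + 2"
        using ij by simp
    qed
  next
    fix i assume i: "p = fps_X ^ i" "2 * i \<le> d + 3"
    show ?thesis
      by (rule zeta_representable_cong[OF zeta_representable_zero])
        (use i in \<open>auto simp: fps_X_power_iff\<close>)
  qed
  then show ?case
    using step by (simp add: zeta_representable_add zeta_representable_scale)
qed

section \<open>Power sums and their convolutions as polynomials\<close>

lemma sum_powers_poly:
  "\<exists>r :: rat poly. degree r \<le> Suc a \<and>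
     (\<forall>m\<ge>1. poly r (of_nat m) = (\<Sum>i=1..<m. of_nat i ^ a))"
proof (induction a rule: less_induct)
  case (less a)
  then have "\<forall>t\<in>{..<a}. \<exists>r :: rat poly. degree r \<le> Suc t \<and>
     (\<forall>m\<ge>1. poly r (of_nat m) = (\<Sum>i=1..<m. of_nat i ^ t))" by blast
  then obtain S :: "nat \<Rightarrow> rat poly" where S: "\<And>t. t < a \<Longrightarrow> degree (S t) \<le> Suc t"
    "\<And>t m. t < a \<Longrightarrow> m \<ge> 1 \<Longrightarrow> poly (S t) (of_nat m) = (\<Sum>i=1..<m. of_nat i ^ t)"
    by (metis lessThan_iff)
  \<comment> \<open>Telescoping (i+1)^(a+1) - i^(a+1) over 1 \<le> i < m and expanding binomially
    gives m^(a+1) - 1 as a combination of the power sums with exponents t \<le> a; \<open>r\<close>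
    solves this for t = a.\<close>
  define r where "r = smult (1 / of_nat (Suc a))
    (monom 1 (Suc a) - 1 - (\<Sum>t<a. smult (of_nat (Suc a choose t)) (S t)))"
  have "degree r \<le> Suc a"
    unfolding r_def using S(1)
    by (intro order.trans[OF degree_smult_le] degree_diff_le degree_sum_le degree_monom_le)
      (auto intro!: order.trans[OF degree_smult_le] intro: order.trans less_imp_le)
  moreover have "poly r (of_nat m) = (\<Sum>i=1..<m. of_nat i ^ a)" if m: "m \<ge> 1" for m
  proof -
    have "of_nat m ^ Suc a - 1 = (\<Sum>i=1..<m. of_nat (Suc i) ^ Suc a - of_nat i ^ Suc a :: rat)"
      using sum_Suc_diff'[OF m, of "\<lambda>i. of_nat i ^ Suc a :: rat"] by simp
    also have "\<dots> = (\<Sum>i=1..<m. \<Sum>t\<le>a. of_nat (Suc a choose t) * of_nat i ^ t)"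
    proof (rule sum.cong[OF refl])
      fix i
      have "of_nat (Suc i) ^ Suc a = (\<Sum>t\<le>Suc a. of_nat (Suc a choose t) * of_nat i ^ t :: rat)"
        using binomial_ring[of "of_nat i :: rat" 1 "Suc a"] by (simp add: add.commute)
      then show "of_nat (Suc i) ^ Suc a - of_nat i ^ Suc a =
        (\<Sum>t\<le>a. of_nat (Suc a choose t) * of_nat i ^ t :: rat)"
        by (simp del: power_Suc binomial_Suc_Suc)
    qed
    also have "\<dots> = (\<Sum>t\<le>a. of_nat (Suc a choose t) * (\<Sum>i=1..<m. of_nat i ^ t))"
      by (subst sum.swap) (simp add: sum_distrib_left)
    also have "\<dots> = (\<Sum>t<a. of_nat (Suc a choose t) * poly (S t) (of_nat m)) +
        of_nat (Suc a) * (\<Sum>i=1..<m. of_nat i ^ a)"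
      using S(2) m by (simp add: lessThan_Suc_atMost[symmetric] del: binomial_Suc_Suc)
    finally show ?thesis
      by (simp add: r_def poly_monom poly_sum field_simps del: of_nat_Suc power_Suc binomial_Suc_Suc)
  qed
  ultimately show ?case by blast
qed

text \<open>Expanding (m - i)^b binomially leaves m^(b-t) times a power sum of exponent a + t, of
  total degree a + b + 1 for every t.\<close>

lemma convolution_powers_poly:
  "\<exists>r :: rat poly. degree r \<le> a + b + 1 \<and>
     (\<forall>m\<ge>1. poly r (of_nat m) = (\<Sum>i=1..<m. of_nat i ^ a * of_nat (m - i) ^ b))"
proof -
  obtain S :: "nat \<Rightarrow> rat poly" where S: "\<And>t. degree (S t) \<le> Suc t"
    "\<And>t m. m \<ge> 1 \<Longrightarrow> poly (S t) (of_nat m) = (\<Sum>i=1..<m. of_nat i ^ t)"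
    using sum_powers_poly by metis
  define r where "r = (\<Sum>t\<le>b. smult (of_nat (b choose t) * (-1) ^ t) (monom 1 (b - t) * S (a + t)))"
  have "degree (monom 1 (b - t) * S (a + t)) \<le> a + b + 1" if "t \<le> b" for t
    using degree_mult_le[of "monom 1 (b - t)" "S (a + t)"] S(1)[of "a + t"] that
      degree_monom_le[of "1 :: rat" "b - t"] by linarith
  then have "degree r \<le> a + b + 1"
    unfolding r_def by (intro degree_sum_le) (auto intro: order.trans[OF degree_smult_le])
  moreover have "poly r (of_nat m) = (\<Sum>i=1..<m. of_nat i ^ a * of_nat (m - i) ^ b)"
    if m: "m \<ge> 1" for m
  proof -
    have "(\<Sum>i=1..<m. of_nat i ^ a * of_nat (m - i) ^ b) =
      (\<Sum>i=1..<m. \<Sum>t\<le>b. of_nat (b choose t) * (-1) ^ t * (of_nat m ^ (b - t) * of_nat i ^ (a + t)) :: rat)"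
    proof (rule sum.cong[OF refl])
      fix i assume "i \<in> {1..<m}"
      then have "of_nat (m - i) ^ b = (- of_nat i + of_nat m :: rat) ^ b"
        by (simp add: of_nat_diff)
      also have "\<dots> = (\<Sum>t\<le>b. of_nat (b choose t) * (- of_nat i) ^ t * of_nat m ^ (b - t))"
        by (rule binomial_ring)
      finally show "of_nat i ^ a * of_nat (m - i) ^ b =
        (\<Sum>t\<le>b. of_nat (b choose t) * (-1) ^ t * (of_nat m ^ (b - t) * of_nat i ^ (a + t)) :: rat)"
        by (simp add: sum_distrib_left power_add power_minus[of "of_nat i"] ac_simps)
    qed
    also have "\<dots> = (\<Sum>t\<le>b. of_nat (b choose t) * (-1) ^ t *
        (of_nat m ^ (b - t) * (\<Sum>i=1..<m. of_nat i ^ (a + t))))"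
      by (subst sum.swap) (simp add: sum_distrib_left)
    finally show ?thesis
      using S(2)[OF m] by (simp add: r_def poly_sum poly_monom)
  qed
  ultimately show ?thesis by blast
qed

lemma convolution_poly:
  fixes q :: "rat poly"
  shows "\<exists>r :: rat poly. degree r \<le> a + degree q + 1 \<and>
     (\<forall>m\<ge>1. poly r (of_nat m) = (\<Sum>i=1..<m. of_nat i ^ a * poly q (of_nat (m - i))))"
proof -
  obtain S :: "nat \<Rightarrow> rat poly" where S: "\<And>s. degree (S s) \<le> a + s + 1"
    "\<And>s m. m \<ge> 1 \<Longrightarrow> poly (S s) (of_nat m) = (\<Sum>i=1..<m. of_nat i ^ a * of_nat (m - i) ^ s)"
    using convolution_powers_poly[of a] by metis
  define r where "r = (\<Sum>s\<le>degree q. smult (coeff q s) (S s))"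
  have "degree (S s) \<le> a + degree q + 1" if "s \<le> degree q" for s
    using S(1)[of s] that by linarith
  then have "degree r \<le> a + degree q + 1"
    unfolding r_def by (intro degree_sum_le) (auto intro: order.trans[OF degree_smult_le])
  moreover have "poly r (of_nat m) = (\<Sum>i=1..<m. of_nat i ^ a * poly q (of_nat (m - i)))"
    if m: "m \<ge> 1" for m
    unfolding poly_altdef[of q] sum_distrib_left
    by (subst sum.swap) (simp add: r_def poly_sum S(2)[OF m] sum_distrib_left ac_simps)
  ultimately show ?thesis by blast
qed

section \<open>Sums over compositions into three parts\<close>

definition triples :: "nat \<Rightarrow> (nat \<times> nat \<times> nat) set" where
  "triples n = {(i, j, k). i + j + k = n \<and> i \<ge> 1 \<and> j \<ge> 1 \<and> k \<ge> 1}"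

text \<open>With k outermost, the inner sum is a convolution at n - k.\<close>

lemma sum_triples:
  "(\<Sum>(i, j, k)\<in>triples n. f i j k) = (\<Sum>k=1..<n. \<Sum>i=1..<n - k. f i (n - k - i) k)"
proof -
  have "(\<Sum>k=1..<n. \<Sum>i=1..<n - k. f i (n - k - i) k) =
     (\<Sum>(k, i)\<in>(SIGMA k:{1..<n}. {1..<n - k}). f i (n - k - i) k)"
    by (rule sum.Sigma) auto
  also have "\<dots> = (\<Sum>(i, j, k)\<in>triples n. f i j k)"
    by (rule sum.reindex_bij_witness[of _ "\<lambda>(i, j, k). (k, i)" "\<lambda>(k, i). (i, n - k - i, k)"])
      (auto simp: triples_def)
  finally show ?thesis ..
qed

lemma sum_triples_swap12: "(\<Sum>(i, j, k)\<in>triples n. f i j k) = (\<Sum>(i, j, k)\<in>triples n. f j i k)"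
  by (rule sum.reindex_bij_witness[of _ "\<lambda>(i, j, k). (j, i, k)" "\<lambda>(i, j, k). (j, i, k)"])
    (auto simp: triples_def)

lemma sum_triples_swap23: "(\<Sum>(i, j, k)\<in>triples n. f i j k) = (\<Sum>(i, j, k)\<in>triples n. f i k j)"
  by (rule sum.reindex_bij_witness[of _ "\<lambda>(i, j, k). (i, k, j)" "\<lambda>(i, j, k). (i, k, j)"])
    (auto simp: triples_def)

lemma fps_mult_nth_pos:
  fixes P Q :: "'a::semiring_0 fps"
  assumes "P $ 0 = 0" "Q $ 0 = 0"
  shows "(P * Q) $ n = (\<Sum>i=1..<n. P $ i * Q $ (n - i))"
  unfolding fps_mult_nth
  by (rule sum.mono_neutral_right) (use assms in \<open>auto simp: not_le not_less Suc_le_eq dest: le_antisym\<close>)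

lemma fps_mult3_nth_pos:
  fixes P Q R :: "'a::comm_semiring_1 fps"
  assumes "P $ 0 = 0" "Q $ 0 = 0" "R $ 0 = 0"
  shows "(P * Q * R) $ n = (\<Sum>(i, j, k)\<in>triples n. P $ i * Q $ j * R $ k)"
proof -
  have "(P * Q * R) $ n = (R * (P * Q)) $ n" by (simp only: ac_simps)
  also have "\<dots> = (\<Sum>k=1..<n. R $ k * (P * Q) $ (n - k))"
    using assms by (intro fps_mult_nth_pos) (auto simp: fps_mult_nth_0)
  also have "\<dots> = (\<Sum>k=1..<n. \<Sum>i=1..<n - k. P $ i * Q $ (n - k - i) * R $ k)"
    using assms by (simp add: fps_mult_nth_pos sum_distrib_left ac_simps)
  finally show ?thesis by (simp only: sum_triples)
qed

text \<open>For a > 0 the divisibility of top-weight parts allows a total weight u + a + 1 of up to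
  2T + 3. For a = 0 there is no such gain and the weight u + 1 must stay within 2T + 2, hence the
  last hypothesis.\<close>

lemma mult_theta_iter_in_zeta_space:
  assumes "P \<in> weight_space u" "u + a \<le> 2 * T + 2" "u + a \<le> d + 2" "a > 0 \<or> u + 1 \<le> 2 * T + 2"
  shows "P * (\<theta> ^^ a) zeta_fps \<in> zeta_space T (d + 3)"
proof (cases a)
  case 0
  have "P * zeta_fps \<in> weight_space (u + Suc 0)"
    by (intro weight_space_mult assms zeta_fps_in_weight_space)
  also have "\<dots> \<subseteq> zeta_space T (u + Suc 0)"
    using assms 0 by (intro weight_space_subset_zeta_space) auto
  also have "\<dots> \<subseteq> zeta_space T (d + 3)"
    using assms by (intro zeta_space_mono) auto
  finally show ?thesis using 0 by simp
next
  case (Suc b)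
  have "P * (\<theta> ^^ Suc b) zeta_fps \<in> deriv_weight_space (u + b)"
    by (intro deriv_weight_space_mult assms theta_iter_in_deriv_weight_space)
  also have "\<dots> \<subseteq> zeta_space T (u + b + 2)"
    using assms Suc by (intro deriv_weight_space_subset_zeta_space) auto
  also have "\<dots> \<subseteq> zeta_space T (d + 3)"
    using assms Suc by (intro zeta_space_mono) auto
  finally show ?thesis using Suc by simp
qed

lemma theta_iter_mult2_in_zeta_space:
  assumes "a + b \<le> d + 1" "d \<le> 2 * T" 
  shows "(\<theta> ^^ a) zeta_fps * (\<theta> ^^ b) zeta_fps \<in> zeta_space T (d + 3)"
proof (cases "b = 0")
  case False
  then show ?thesis
    using assms by (intro mult_theta_iter_in_zeta_space[of _ "Suc a"] theta_iter_in_weight_space) auto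
next
  case True
  then have "(\<theta> ^^ b) zeta_fps * (\<theta> ^^ a) zeta_fps \<in> zeta_space T (d + 3)"
    using assms by (intro mult_theta_iter_in_zeta_space[of _ "Suc b"] theta_iter_in_weight_space) auto
  then show ?thesis by (simp only: mult.commute)
qed

lemma theta_iter_mult3_in_zeta_space:
  assumes "a + b + c \<le> d" "d \<le> 2 * T" "T \<ge> 1"
  shows "(\<theta> ^^ a) zeta_fps * (\<theta> ^^ b) zeta_fps * (\<theta> ^^ c) zeta_fps \<in> zeta_space T (d + 3)"
proof -
  have *: "(\<theta> ^^ a) zeta_fps * (\<theta> ^^ b) zeta_fps * (\<theta> ^^ c) zeta_fps \<in> zeta_space T (d + 3)"
    if "a + b + c \<le> d" "c > 0 \<or> a + b = 0" for a b c
    using assms that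
    by (intro mult_theta_iter_in_zeta_space[of _ "Suc a + Suc b"] weight_space_mult
        theta_iter_in_weight_space) auto
  \<comment> \<open>A differentiated factor, if there is one, is moved to the end. Otherwise the
    product is H^3, of weight 3, which fits because \<open>T \<ge> 1\<close>.\<close>
  consider "c > 0 \<or> a + b = 0" | "b > 0" | "a > 0" by auto
  then show ?thesis
    using *[of a b c] *[of a c b] *[of c b a] assms(1) by cases (simp_all add: ac_simps)
qed

lemma representable_triple_product:
  assumes "a + b + c \<le> d" "d \<le> 2 * T" "T \<ge> 1" "T \<le> d + 2"
  shows "zeta_representable d T (\<lambda>n. \<Sum>(i, j, k)\<in>triples n. of_nat i ^ a * of_nat j ^ b * of_nat k ^ c *
    (zeta_ratio i * zeta_ratio j * zeta_ratio k))"
proof (rule zeta_representable_cong[OF zeta_space_representable[OF theta_iter_mult3_in_zeta_space]])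
  show "((\<theta> ^^ a) zeta_fps * (\<theta> ^^ b) zeta_fps * (\<theta> ^^ c) zeta_fps) $ n =
    (\<Sum>(i, j, k)\<in>triples n. of_nat i ^ a * of_nat j ^ b * of_nat k ^ c *
    (zeta_ratio i * zeta_ratio j * zeta_ratio k))" for n
    by (subst fps_mult3_nth_pos) (simp_all add: theta_iter_nth ac_simps)
qed (use assms in auto)

text \<open>Summing i^a j^b over i + j = m gives a polynomial in m of degree at most a + b + 1. So
  only products of \<theta>^c H and \<theta>^s H with c + s \<le> d + 1 occur, of weight at most d +
  3 like the triple products.\<close>

lemma representable_double_product:
  assumes "a + b + c \<le> d" "d \<le> 2 * T" "T \<le> d + 2"
  shows "zeta_representable d T (\<lambda>n. \<Sum>(i, j, k)\<in>triples n. of_nat i ^ a * of_nat j ^ b * of_nat k ^ c *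
    (zeta_ratio (i + j) * zeta_ratio k))"
proof -
  obtain r :: "rat poly" where r: "degree r \<le> a + b + 1"
    "\<And>m. m \<ge> 1 \<Longrightarrow> poly r (of_nat m) = (\<Sum>i=1..<m. of_nat i ^ a * of_nat (m - i) ^ b)"
    using convolution_powers_poly by blast
  have "zeta_representable d T
     (\<lambda>n. \<Sum>s\<le>degree r. coeff r s * ((\<theta> ^^ c) zeta_fps * (\<theta> ^^ s) zeta_fps) $ n)"
    using assms r(1)
    by (intro zeta_representable_sum zeta_representable_scale zeta_space_representable
        theta_iter_mult2_in_zeta_space) auto
  then show ?thesis
  proof (rule zeta_representable_cong)
    fix n
    have "(\<Sum>s\<le>degree r. coeff r s * ((\<theta> ^^ c) zeta_fps * (\<theta> ^^ s) zeta_fps) $ n) =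
      (\<Sum>s\<le>degree r. \<Sum>k=1..<n. coeff r s * (of_nat k ^ c * zeta_ratio k *
          (of_nat (n - k) ^ s * zeta_ratio (n - k))))"
      by (simp add: fps_mult_nth_pos theta_iter_nth sum_distrib_left)
    also have "\<dots> = (\<Sum>k=1..<n. of_nat k ^ c * zeta_ratio k * zeta_ratio (n - k) *
        poly r (of_nat (n - k)))"
      by (subst sum.swap) (simp add: poly_altdef sum_distrib_left ac_simps)
    also have "\<dots> = (\<Sum>k=1..<n. \<Sum>i=1..<n - k. of_nat i ^ a * of_nat (n - k - i) ^ b * of_nat k ^ c *
       (zeta_ratio (i + (n - k - i)) * zeta_ratio k))"
      by (rule sum.cong[OF refl], subst r(2)) (auto simp: sum_distrib_left ac_simps intro!: sum.cong)
    finally show "(\<Sum>s\<le>degree r. coeff r s * ((\<theta> ^^ c) zeta_fps * (\<theta> ^^ s) zeta_fps) $ n) =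
       (\<Sum>(i, j, k)\<in>triples n. of_nat i ^ a * of_nat j ^ b * of_nat k ^ c *
         (zeta_ratio (i + j) * zeta_ratio k))"
      by (simp only: sum_triples)
  qed
qed

text \<open>Only k = 0 is used; the two nested summations each add one to the degree, which gives d
  + 2.\<close>

lemma representable_single:
  assumes "a + b + c \<le> d"
  shows "zeta_representable d T (\<lambda>n. \<Sum>(i, j, k)\<in>triples n. of_nat i ^ a * of_nat j ^ b * of_nat k ^ c *
    zeta_ratio (i + j + k))"
proof -
  obtain r :: "rat poly" where r: "degree r \<le> a + b + 1"
    "\<And>m. m \<ge> 1 \<Longrightarrow> poly r (of_nat m) = (\<Sum>i=1..<m. of_nat i ^ a * of_nat (m - i) ^ b)"
    using convolution_powers_poly by blast
  obtain q :: "rat poly" where q: "degree q \<le> c + degree r + 1"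
    "\<And>n. n \<ge> 1 \<Longrightarrow> poly q (of_nat n) = (\<Sum>k=1..<n. of_nat k ^ c * poly r (of_nat (n - k)))"
    using convolution_poly by blast
  have "zeta_representable d T (\<lambda>n. poly q (of_nat n) * zeta_ratio n)"
    using q(1) r(1) assms by (intro zeta_representable_poly) simp
  then show ?thesis
  proof (rule zeta_representable_cong)
    fix n assume "d + 2 \<le> n"
    then have "poly q (of_nat n) * zeta_ratio n =
      (\<Sum>k=1..<n. of_nat k ^ c * poly r (of_nat (n - k))) * zeta_ratio n"
      by (simp add: q(2))
    also have "\<dots> = (\<Sum>k=1..<n. \<Sum>i=1..<n - k. of_nat i ^ a * of_nat (n - k - i) ^ b * of_nat k ^ c *
        zeta_ratio (i + (n - k - i) + k))"
      unfolding sum_distrib_right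
      by (rule sum.cong[OF refl], subst r(2))
        (auto simp: sum_distrib_left sum_distrib_right ac_simps intro!: sum.cong)
    finally show "poly q (of_nat n) * zeta_ratio n = (\<Sum>(i, j, k)\<in>triples n.
        of_nat i ^ a * of_nat j ^ b * of_nat k ^ c * zeta_ratio (i + j + k))"
      by (simp only: sum_triples)
  qed
qed

text \<open>
  Multiplied by \<open>\<zeta>(2)^(i + j + k)\<close>, this is the sum of
  \<open>m\<^sub>1^(-2i) m\<^sub>2^(-2j) m\<^sub>3^(-2k)\<close> over pairwise distinct positive integers.
\<close>

definition distinct_ratio :: "nat \<Rightarrow> nat \<Rightarrow> nat \<Rightarrow> rat" where
  "distinct_ratio i j k = zeta_ratio i * zeta_ratio j * zeta_ratio k - zeta_ratio (i + j) * zeta_ratio k -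
     zeta_ratio (i + k) * zeta_ratio j - zeta_ratio (j + k) * zeta_ratio i + 2 * zeta_ratio (i + j + k)"

lemma representable_monomial:
  assumes "a + b + c \<le> d" "d \<le> 2 * T" "T \<ge> 1" "T \<le> d + 2"
  shows "zeta_representable d T
    (\<lambda>n. \<Sum>(i, j, k)\<in>triples n. of_nat i ^ a * of_nat j ^ b * of_nat k ^ c * distinct_ratio i j k)"
proof -
  let ?m = "\<lambda>i j k. of_nat i ^ a * of_nat j ^ b * of_nat k ^ c :: rat"
  \<comment> \<open>Permuting the summation indices together with the exponents reduces the other
    two pairings to the one treated in \<open>representable_double_product\<close>.\<close>
  have ik: "zeta_representable d T
      (\<lambda>n. \<Sum>(i, j, k)\<in>triples n. ?m i j k * (zeta_ratio (i + k) * zeta_ratio j))"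
    using representable_double_product[of a c b d T] assms
    by (subst sum_triples_swap23) (simp add: ac_simps)
  have jk: "zeta_representable d T
      (\<lambda>n. \<Sum>(i, j, k)\<in>triples n. ?m i j k * (zeta_ratio (j + k) * zeta_ratio i))"
    using representable_double_product[of b c a d T] assms
    by (subst sum_triples_swap12, subst sum_triples_swap23) (simp add: ac_simps)
  have "zeta_representable d T
    (\<lambda>n. (\<Sum>(i, j, k)\<in>triples n. ?m i j k * (zeta_ratio i * zeta_ratio j * zeta_ratio k)) +
      (-1) * (\<Sum>(i, j, k)\<in>triples n. ?m i j k * (zeta_ratio (i + j) * zeta_ratio k)) +
      (-1) * (\<Sum>(i, j, k)\<in>triples n. ?m i j k * (zeta_ratio (i + k) * zeta_ratio j)) +
      (-1) * (\<Sum>(i, j, k)\<in>triples n. ?m i j k * (zeta_ratio (j + k) * zeta_ratio i)) +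
      2 * (\<Sum>(i, j, k)\<in>triples n. ?m i j k * zeta_ratio (i + j + k)))"
    using assms
    by (intro zeta_representable_add zeta_representable_scale ik jk representable_triple_product
        representable_double_product representable_single) auto
  then show ?thesis
    by (rule zeta_representable_cong)
      (simp add: distinct_ratio_def sum_distrib_left case_prod_unfold algebra_simps
         flip: sum.distrib sum_subtractf)
qed

lemma representable_imp_zeta:
  assumes "zeta_representable d T f" "T \<le> d + 1"
  shows "\<exists>C :: nat \<Rightarrow> rat poly. (\<forall>k\<le>T. degree (C k) \<le> d + 2) \<and>
    (\<forall>n\<ge>d + 2. real_of_rat (f n) * zeta 2 ^ n =
      (\<Sum>k=0..T. real_of_rat (poly (C k) (of_nat n)) * zeta (2 * k) * zeta (2 * n - 2 * k)))"
proof -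
  obtain C where C: "\<forall>k\<le>T. degree (C k) \<le> d + 2"
      "\<forall>n\<ge>d + 2. f n = (\<Sum>k=0..T. poly (C k) (of_nat n) * zeta_ratio (n - k))"
    using assms unfolding zeta_representable_def by blast
  \<comment> \<open>The scalar cancels the rational part of zeta(2k): that is
    \<open>zeta_ratio k\<close> for k > 0, while zeta(0) = -1/2 accounts for the -2.\<close>
  define D where "D k = smult (if k = 0 then -2 else 1 / zeta_ratio k) (C k)" for k
  have "\<forall>k\<le>T. degree (D k) \<le> d + 2"
    using C(1) by (auto simp: D_def intro: order.trans[OF degree_smult_le])
  moreover have "real_of_rat (f n) * zeta 2 ^ n =
      (\<Sum>k=0..T. real_of_rat (poly (D k) (of_nat n)) * zeta (2 * k) * zeta (2 * n - 2 * k))"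
    if n: "n \<ge> d + 2" for n
  proof -
    have "real_of_rat (f n) * zeta 2 ^ n =
      (\<Sum>k=0..T. real_of_rat (poly (C k) (of_nat n)) * (real_of_rat (zeta_ratio (n - k)) * zeta 2 ^ n))"
      using C(2) n by (simp add: of_rat_sum of_rat_mult sum_distrib_right mult.assoc)
    also have "\<dots> =
      (\<Sum>k=0..T. real_of_rat (poly (D k) (of_nat n)) * zeta (2 * k) * zeta (2 * n - 2 * k))"
    proof (rule sum.cong[OF refl])
      fix k assume "k \<in> {0..T}"
      \<comment> \<open>The case n - k = 0 must be excluded because \<open>zeta_ratio 0\<close> is 0
        whereas \<open>zeta 0\<close> is -1/2.\<close>
      then have kn: "n - k \<ge> 1" using assms(2) n by simp
      have zn: "zeta (2 * n - 2 * k) = real_of_rat (zeta_ratio (n - k)) * zeta 2 ^ (n - k)"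
        using zeta_even_eq[OF kn] by (simp add: diff_mult_distrib2)
      have "zeta 2 ^ n = zeta 2 ^ k * zeta 2 ^ (n - k)"
        using kn by (simp add: power_add[symmetric])
      moreover have "real_of_rat (poly (D k) (of_nat n)) * zeta (2 * k) =
          real_of_rat (poly (C k) (of_nat n)) * zeta 2 ^ k"
      proof (cases "k = 0")
        case True
        then show ?thesis by (simp add: D_def of_rat_mult of_rat_minus zeta_def)
      next
        case False
        then show ?thesis
          using zeta_even_eq[of k] zeta_ratio_nonzero[of k]
          by (simp add: D_def of_rat_mult of_rat_divide)
      qed
      ultimately show "real_of_rat (poly (C k) (of_nat n)) * (real_of_rat (zeta_ratio (n - k)) * zeta 2 ^ n) =
         real_of_rat (poly (D k) (of_nat n)) * zeta (2 * k) * zeta (2 * n - 2 * k)"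
        using zn by (simp add: ac_simps)
    qed
    finally show ?thesis .
  qed
  ultimately show ?thesis by blast
qed

section \<open>Permutation sums of triple zeta values\<close>

lemma has_sum_Times_mult:
  fixes f :: "'a \<Rightarrow> real" and g :: "'b \<Rightarrow> real"
  assumes f: "(f has_sum s) A" and g: "(g has_sum t) B"
    and nonneg: "\<And>x. x \<in> A \<Longrightarrow> f x \<ge> 0" "\<And>y. y \<in> B \<Longrightarrow> g y \<ge> 0"
  shows "((\<lambda>(x, y). f x * g y) has_sum (s * t)) (A \<times> B)"
proof (rule has_sum_SigmaI)
  show inner: "((\<lambda>y. case (x, y) of (x, y) \<Rightarrow> f x * g y) has_sum (f x * t)) B" for x
    using has_sum_cmult_right[OF g] by simp
  show outer: "((\<lambda>x. f x * t) has_sum (s * t)) A" by (rule has_sum_cmult_left[OF f])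
  show "(\<lambda>(x, y). f x * g y) summable_on A \<times> B"
    using inner has_sum_imp_summable[OF outer] by (rule summable_on_SigmaI) (auto simp: nonneg)
qed

text \<open>Summing over all naturals is harmless: the term m = 0 is 1/0 = 0.\<close>

lemma zeta_has_sum:
  assumes "s \<ge> 2"
  shows "((\<lambda>m. 1 / real m ^ s) has_sum zeta s) UNIV"
proof (rule sums_nonneg_imp_has_sum)
  have "(\<lambda>m. 1 / real m ^ s) sums (zeta s + 1 / real 0 ^ s)"
    using zeta_sums[OF assms] by (subst (asm) sums_Suc_iff) simp
  then show "(\<lambda>m. 1 / real m ^ s) sums zeta s"
    using assms by (simp add: power_0_left)
qed simp

lemma has_sum_restrict_UNIV:
  "(f has_sum s) A \<longleftrightarrow> ((\<lambda>x. if x \<in> A then f x else 0) has_sum s) UNIV"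
  by (rule has_sum_cong_neutral) auto

text \<open>Inclusion-exclusion: the triples of positive integers split into six strict orderings
  and the union of the planes x = y, x = z, y = z. All three planes contain the full diagonal, so it
  is counted twice too often.\<close>

lemma sum_triple_zeta_permutations:
  assumes "a \<ge> 2" "b \<ge> 2" "c \<ge> 2"
  shows "triple_zeta a b c + triple_zeta a c b + triple_zeta b a c +
      triple_zeta b c a + triple_zeta c a b + triple_zeta c b a =
    zeta a * zeta b * zeta c - zeta (a + b) * zeta c - zeta (a + c) * zeta b -
      zeta (b + c) * zeta a + 2 * zeta (a + b + c)"
proof -
  let ?A = "{(x, y, z). x > y \<and> y > z \<and> z > (0::nat)}"
  define f where "f = (\<lambda>(x, y, z). 1 / (real x ^ a * real y ^ b * real z ^ c))"
  \<comment> \<open>\<open>f\<close> vanishes as soon as one argument is \<open>0\<close>, since \<open>1 / 0 = 0\<close>\<close>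
  note zs = assms[THEN zeta_has_sum]
  have "((\<lambda>(x, y, z). 1 / real x ^ a * (case (y, z) of (y, z) \<Rightarrow> 1 / real y ^ b * (1 / real z ^ c)))
      has_sum (zeta a * (zeta b * zeta c))) (UNIV \<times> UNIV \<times> UNIV)"
    using has_sum_Times_mult[OF zs(1) has_sum_Times_mult[OF zs(2,3)]] by (simp add: case_prod_unfold)
  then have total: "(f has_sum (zeta a * zeta b * zeta c)) UNIV"
    by (simp add: f_def mult.assoc)
  have 3: "((\<lambda>(x, y). 1 / real x ^ u * (1 / real y ^ v)) has_sum (zeta u * zeta v)) UNIV"
    if "u \<ge> 2" "v \<ge> 2" for u v
    using has_sum_Times_mult[OF zeta_has_sum zeta_has_sum, OF that] by simp
  have xy: "(f has_sum (zeta (a + b) * zeta c)) {(x, y, z). x = y}"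
    by (rule has_sum_reindex_bij_witness[THEN iffD1, OF _ _ _ _ _ refl 3, where
          i1 = "\<lambda>(x, y, z). (x, z)" and j1 = "\<lambda>(x, z). (x, x, z)"])
      (use assms in \<open>auto simp: f_def power_add\<close>)
  have xz: "(f has_sum (zeta (a + c) * zeta b)) {(x, y, z). x = z}"
    by (rule has_sum_reindex_bij_witness[THEN iffD1, OF _ _ _ _ _ refl 3, where
          i1 = "\<lambda>(x, y, z). (x, y)" and j1 = "\<lambda>(x, y). (x, y, x)"])
      (use assms in \<open>auto simp: f_def power_add\<close>)
  have yz: "(f has_sum (zeta (b + c) * zeta a)) {(x, y, z). y = z}"
    by (rule has_sum_reindex_bij_witness[THEN iffD1, OF _ _ _ _ _ refl 3, where
          i1 = "\<lambda>(x, y, z). (y, x)" and j1 = "\<lambda>(y, x). (x, y, y)"])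
      (use assms in \<open>auto simp: f_def power_add\<close>)
  have diag: "(f has_sum zeta (a + b + c)) {(x, y, z). x = y \<and> y = z}"
    by (rule has_sum_reindex_bij_witness[THEN iffD1, OF _ _ _ _ _ refl zeta_has_sum, where
          i1 = "\<lambda>(x, y, z). x" and j1 = "\<lambda>x. (x, x, x)"])
      (use assms in \<open>auto simp: f_def power_add\<close>)
  \<comment> \<open>Summability over all triples passes to every subset, so each
    \<open>triple_zeta\<close>, an \<open>infsum\<close>, becomes a genuine sum over a
    region.\<close>
  have sub: "(f has_sum s) S" if "infsum f S = s" for S s
    using has_sum_infsum[OF summable_on_subset[OF has_sum_imp_summable[OF total] subset_UNIV]] that
    by (rule subst[rotated])
  have 1: "(f has_sum triple_zeta a b c) {(x, y, z). (x, y, z) \<in> ?A}"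
    unfolding triple_zeta_def
    by (rule sub, rule infsum_reindex_bij_witness[of _ "\<lambda>(x, y, z). (x, y, z)" "\<lambda>(x, y, z). (x, y, z)"])
      (auto simp: f_def ac_simps)
  have 2: "(f has_sum triple_zeta a c b) {(x, z, y). (x, y, z) \<in> ?A}"
    unfolding triple_zeta_def
    by (rule sub, rule infsum_reindex_bij_witness[of _ "\<lambda>(x, y, z). (x, z, y)" "\<lambda>(x, z, y). (x, y, z)"])
      (auto simp: f_def ac_simps)
  have 3: "(f has_sum triple_zeta b a c) {(y, x, z). (x, y, z) \<in> ?A}"
    unfolding triple_zeta_def
    by (rule sub, rule infsum_reindex_bij_witness[of _ "\<lambda>(x, y, z). (y, x, z)" "\<lambda>(y, x, z). (x, y, z)"])
      (auto simp: f_def ac_simps)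
  have 4: "(f has_sum triple_zeta b c a) {(z, x, y). (x, y, z) \<in> ?A}"
    unfolding triple_zeta_def
    by (rule sub, rule infsum_reindex_bij_witness[of _ "\<lambda>(x, y, z). (z, x, y)" "\<lambda>(z, x, y). (x, y, z)"])
      (auto simp: f_def ac_simps)
  have 5: "(f has_sum triple_zeta c a b) {(y, z, x). (x, y, z) \<in> ?A}"
    unfolding triple_zeta_def
    by (rule sub, rule infsum_reindex_bij_witness[of _ "\<lambda>(x, y, z). (y, z, x)" "\<lambda>(y, z, x). (x, y, z)"])
      (auto simp: f_def ac_simps)
  have 6: "(f has_sum triple_zeta c b a) {(z, y, x). (x, y, z) \<in> ?A}"
    unfolding triple_zeta_def
    by (rule sub, rule infsum_reindex_bij_witness[of _ "\<lambda>(x, y, z). (z, y, x)" "\<lambda>(z, y, x). (x, y, z)"])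
      (auto simp: f_def ac_simps)
  \<comment> \<open>Extended by zero to all triples, the summands on both sides can be compared
    pointwise, according to the order of the coordinates.\<close>
  note ind = has_sum_restrict_UNIV[THEN iffD1]
  note lhs = has_sum_add[OF has_sum_add[OF has_sum_add[OF has_sum_add[OF has_sum_add[OF has_sum_add[OF
    has_sum_add[OF has_sum_add[OF 1[THEN ind] 2[THEN ind]] 3[THEN ind]] 4[THEN ind]] 5[THEN ind]]
    6[THEN ind]] xy[THEN ind]] xz[THEN ind]] yz[THEN ind]]
  note rhs = has_sum_add[OF total has_sum_cmult_right[OF diag[THEN ind], of 2]]
  have "triple_zeta a b c + triple_zeta a c b + triple_zeta b a c +
      triple_zeta b c a + triple_zeta c a b + triple_zeta c b a +
      zeta (a + b) * zeta c + zeta (a + c) * zeta b + zeta (b + c) * zeta a =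
      zeta a * zeta b * zeta c + 2 * zeta (a + b + c)"
  proof (rule has_sum_unique[OF lhs rhs[THEN has_sum_cong[THEN iffD1, rotated]]], clarify, goal_cases)
    case (1 x y z)
    show ?case
    proof (cases "x = 0 \<or> y = 0 \<or> z = 0")
      case True
      then have "f (x, y, z) = 0" using assms by (auto simp: f_def)
      then show ?thesis by (simp only: if_cancel mult_zero_right add_0_left)
    next
      case False
      then show ?thesis
        by (cases x y rule: linorder_cases; cases y z rule: linorder_cases;
            cases x z rule: linorder_cases) auto
    qed
  qed
  then show ?thesis by simp
qed

section \<open>Symmetrisation of the weighted sum\<close>

lemma eval3_swap12:
  assumes "symmetric3 F"
  shows "eval3 F y x z = eval3 F x y z"
proof -
  have "Poly_Mapping.lookup F (b, a, c) = Poly_Mapping.lookup F (a, b, c)" for a b c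
    using assms by (simp add: symmetric3_def)
  then show ?thesis
    unfolding eval3_def
    by (intro sum.reindex_bij_witness[of _ "\<lambda>(a, b, c). (b, a, c)" "\<lambda>(a, b, c). (b, a, c)"])
      (auto simp: in_keys_iff ac_simps)
qed

lemma eval3_swap23:
  assumes "symmetric3 F"
  shows "eval3 F x z y = eval3 F x y z"
proof -
  have "Poly_Mapping.lookup F (a, c, b) = Poly_Mapping.lookup F (a, b, c)" for a b c
    using assms by (simp add: symmetric3_def)
  then show ?thesis
    unfolding eval3_def
    by (intro sum.reindex_bij_witness[of _ "\<lambda>(a, b, c). (a, c, b)" "\<lambda>(a, b, c). (a, c, b)"])
      (auto simp: in_keys_iff ac_simps)
qed

lemma sum_triple_zeta_even_permutations:
  assumes "i \<ge> 1" "j \<ge> 1" "k \<ge> 1"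
  shows "triple_zeta (2 * i) (2 * j) (2 * k) + triple_zeta (2 * i) (2 * k) (2 * j) +
      triple_zeta (2 * j) (2 * i) (2 * k) + triple_zeta (2 * j) (2 * k) (2 * i) +
      triple_zeta (2 * k) (2 * i) (2 * j) + triple_zeta (2 * k) (2 * j) (2 * i) =
    real_of_rat (distinct_ratio i j k) * zeta 2 ^ (i + j + k)"
proof -
  have z: "zeta (2 * i) = real_of_rat (zeta_ratio i) * zeta 2 ^ i"
    "zeta (2 * j) = real_of_rat (zeta_ratio j) * zeta 2 ^ j"
    "zeta (2 * k) = real_of_rat (zeta_ratio k) * zeta 2 ^ k"
    "zeta (2 * i + 2 * j) = real_of_rat (zeta_ratio (i + j)) * zeta 2 ^ (i + j)"
    "zeta (2 * i + 2 * k) = real_of_rat (zeta_ratio (i + k)) * zeta 2 ^ (i + k)"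
    "zeta (2 * j + 2 * k) = real_of_rat (zeta_ratio (j + k)) * zeta 2 ^ (j + k)"
    "zeta (2 * i + 2 * j + 2 * k) = real_of_rat (zeta_ratio (i + j + k)) * zeta 2 ^ (i + j + k)"
    using assms zeta_even_eq[of i] zeta_even_eq[of j] zeta_even_eq[of k] zeta_even_eq[of "i + j"]
      zeta_even_eq[of "i + k"] zeta_even_eq[of "j + k"] zeta_even_eq[of "i + j + k"]
    by (simp_all add: algebra_simps)
  have "triple_zeta (2 * i) (2 * j) (2 * k) + triple_zeta (2 * i) (2 * k) (2 * j) +
      triple_zeta (2 * j) (2 * i) (2 * k) + triple_zeta (2 * j) (2 * k) (2 * i) +
      triple_zeta (2 * k) (2 * i) (2 * j) + triple_zeta (2 * k) (2 * j) (2 * i) =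
      zeta (2 * i) * zeta (2 * j) * zeta (2 * k) - zeta (2 * i + 2 * j) * zeta (2 * k) -
      zeta (2 * i + 2 * k) * zeta (2 * j) - zeta (2 * j + 2 * k) * zeta (2 * i) +
      2 * zeta (2 * i + 2 * j + 2 * k)"
    using assms by (intro sum_triple_zeta_permutations) auto
  then show ?thesis
    unfolding z distinct_ratio_def
    by (simp add: of_rat_add of_rat_diff of_rat_mult power_add algebra_simps)
qed

text \<open>The weight is invariant under permutations of i, j, k, so permuting the arguments of the
  triple zeta value does not change the sum; the six copies combine by
  \<open>sum_triple_zeta_even_permutations\<close>.\<close>

lemma sum_symmetric_triple_zeta:
  assumes "symmetric3 F"
  shows "6 * (\<Sum>(i, j, k)\<in>triples n. real_of_rat (eval3 F (of_nat i) (of_nat j) (of_nat k)) *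
      triple_zeta (2 * i) (2 * j) (2 * k)) =
    real_of_rat (\<Sum>(i, j, k)\<in>triples n. eval3 F (of_nat i) (of_nat j) (of_nat k) * distinct_ratio i j k) *
      zeta 2 ^ n"
proof -
  define g where "g i j k = real_of_rat (eval3 F (of_nat i) (of_nat j) (of_nat k))" for i j k :: nat
  define t where "t i j k = triple_zeta (2 * i) (2 * j) (2 * k)" for i j k
  define S where "S = (\<Sum>(i, j, k)\<in>triples n. g i j k * t i j k)"
  have g: "g j i k = g i j k" "g i k j = g i j k" for i j k
    unfolding g_def using eval3_swap12[OF assms] eval3_swap23[OF assms] by metis+
  have ikj: "(\<Sum>(i, j, k)\<in>triples n. g i j k * t i k j) = S"
    unfolding S_def by (subst sum_triples_swap23) (simp only: g(2))
  have jik: "(\<Sum>(i, j, k)\<in>triples n. g i j k * t j i k) = S"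
    unfolding S_def by (subst sum_triples_swap12) (simp only: g(1))
  have jki: "(\<Sum>(i, j, k)\<in>triples n. g i j k * t j k i) = S"
    unfolding ikj[symmetric] by (subst sum_triples_swap12) (simp only: g(1))
  have kij: "(\<Sum>(i, j, k)\<in>triples n. g i j k * t k i j) = S"
    unfolding jik[symmetric] by (subst sum_triples_swap23) (simp only: g(2))
  have kji: "(\<Sum>(i, j, k)\<in>triples n. g i j k * t k j i) = S"
    unfolding kij[symmetric] by (subst sum_triples_swap12) (simp only: g(1))
  have "6 * S = (\<Sum>(i, j, k)\<in>triples n. g i j k * t i j k) + (\<Sum>(i, j, k)\<in>triples n. g i j k * t i k j) +
      (\<Sum>(i, j, k)\<in>triples n. g i j k * t j i k) + (\<Sum>(i, j, k)\<in>triples n. g i j k * t j k i) +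
      (\<Sum>(i, j, k)\<in>triples n. g i j k * t k i j) + (\<Sum>(i, j, k)\<in>triples n. g i j k * t k j i)"
    unfolding ikj jik jki kij kji S_def[symmetric] by simp
  also have "\<dots> = (\<Sum>(i, j, k)\<in>triples n.
      g i j k * (t i j k + t i k j + t j i k + t j k i + t k i j + t k j i))"
    by (simp add: case_prod_unfold distrib_left sum.distrib)
  also have "\<dots> = (\<Sum>(i, j, k)\<in>triples n. g i j k * (real_of_rat (distinct_ratio i j k) * zeta 2 ^ n))"
    by (rule sum.cong[OF refl])
      (auto simp: t_def triples_def sum_triple_zeta_even_permutations simp flip: One_nat_def)
  also have "\<dots> = real_of_rat (\<Sum>(i, j, k)\<in>triples n.
      eval3 F (of_nat i) (of_nat j) (of_nat k) * distinct_ratio i j k) * zeta 2 ^ n"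
    by (simp add: g_def of_rat_sum of_rat_mult case_prod_unfold sum_distrib_right mult.assoc)
  finally show ?thesis by (simp only: S_def g_def t_def)
qed

theorem theorem4p5:
  fixes F :: "rat poly3" and d T :: nat
  assumes "symmetric3 F" and "F \<noteq> 0" and "total_degree3 F = d"
    and "T = max ((d + 1) div 2) 1"
  shows "\<exists>C :: nat \<Rightarrow> rat poly.
    (\<forall>k\<le>T. Polynomial.degree (C k) \<le> d + 2) \<and>
    (\<forall>n::nat. n > 0 \<and> n \<ge> d + 2 \<longrightarrow>
      (\<Sum>(i, j, k)\<in>{(i, j, k). i + j + k = n \<and> i \<ge> 1 \<and> j \<ge> 1 \<and> k \<ge> 1}.
          real_of_rat (eval3 F (of_nat i) (of_nat j) (of_nat k)) *
          triple_zeta (2 * i) (2 * j) (2 * k)) =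
      (\<Sum>k=0..T. real_of_rat (poly (C k) (of_nat n)) * zeta (2 * k) * zeta (2 * n - 2 * k)))"
proof -
  \<comment> \<open>The left-hand side divided by zeta(2)^n, expanded into monomials of
    \<open>F\<close>; the factor 1/6 undoes the symmetrisation.\<close>
  define f where "f = (\<lambda>n. 1 / 6 * (\<Sum>(a, b, c)\<in>Poly_Mapping.keys F. Poly_Mapping.lookup F (a, b, c) *
    (\<Sum>(i, j, k)\<in>triples n. of_nat i ^ a * of_nat j ^ b * of_nat k ^ c * distinct_ratio i j k)))"
  have deg: "a + b + c \<le> d" if "(a, b, c) \<in> Poly_Mapping.keys F" for a b c
    unfolding assms(3)[symmetric] total_degree3_def using that by (intro Max_ge) force+
  have "zeta_representable d T f"
    unfolding f_def
  proof (intro zeta_representable_scale zeta_representable_sum)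
    fix x assume "x \<in> Poly_Mapping.keys F"
    then obtain a b c where x: "x = (a, b, c)" "a + b + c \<le> d" using deg by (cases x) auto
    \<comment> \<open>\<open>T \<ge> (d + 1) div 2\<close> yields \<open>d \<le> 2 * T\<close>, the
      bound needed for top weight d + 3.\<close>
    have "zeta_representable d T (\<lambda>n. Poly_Mapping.lookup F (a, b, c) *
      (\<Sum>(i, j, k)\<in>triples n. of_nat i ^ a * of_nat j ^ b * of_nat k ^ c * distinct_ratio i j k))"
      using x(2) assms(4) by (intro zeta_representable_scale representable_monomial) auto
    then show "zeta_representable d T (\<lambda>n. case x of (a, b, c) \<Rightarrow> Poly_Mapping.lookup F (a, b, c) *
      (\<Sum>(i, j, k)\<in>triples n. of_nat i ^ a * of_nat j ^ b * of_nat k ^ c * distinct_ratio i j k))"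
      by (simp add: x(1))
  qed
  then obtain C where C: "\<forall>k\<le>T. degree (C k) \<le> d + 2"
     "\<forall>n\<ge>d + 2. real_of_rat (f n) * zeta 2 ^ n =
      (\<Sum>k=0..T. real_of_rat (poly (C k) (of_nat n)) * zeta (2 * k) * zeta (2 * n - 2 * k))"
    using representable_imp_zeta[of d T f] assms(4) by auto
  have "(\<Sum>(i, j, k)\<in>triples n. real_of_rat (eval3 F (of_nat i) (of_nat j) (of_nat k)) *
      triple_zeta (2 * i) (2 * j) (2 * k)) = real_of_rat (f n) * zeta 2 ^ n" for n
  proof -
    have "f n = 1 / 6 * (\<Sum>(i, j, k)\<in>triples n. eval3 F (of_nat i) (of_nat j) (of_nat k) * distinct_ratio i j k)"
      unfolding f_def eval3_def case_prod_unfold sum_distrib_left sum_distrib_right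
      by (subst sum.swap) (simp only: ac_simps)
    then have f6: "real_of_rat (f n) = 1 / 6 * real_of_rat (\<Sum>(i, j, k)\<in>triples n.
        eval3 F (of_nat i) (of_nat j) (of_nat k) * distinct_ratio i j k)"
      by (simp only: of_rat_mult of_rat_divide of_rat_1 of_rat_numeral_eq)
    show ?thesis
      using sum_symmetric_triple_zeta[OF assms(1), of n] unfolding f6 by simp
  qed
  with C show ?thesis
    unfolding triples_def by (intro exI[of _ C]) auto
qed

end
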